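(* Let $0<\alpha<2$ and let $Q$ be the L\'evy measure of a stationary $\alpha$-stable process. In the canonical factorization $$\mathbb{P}_Q=\mathbb{P}_{Q_B}*\mathbb{P}_{Q_m}*\mathbb{P}_{Q_{wm}}*\mathbb{P}_{Q_{ne}}$$ each of the four factors is the distribution of a stationary $\alpha$-stable process.
   Context: **IDp processes.** $T$ is the shift on $\mathbb{R}^{\mathbb{Z}}$, $T\{x_i\}=\{x_{i+1}\}$, $\mathcal{B}$ the Borel $\sigma$-algebra of $\mathbb{R}$. A L\'evy measure of a stationary IDp process is a $\sigma$-finite shift-invariant measure $Q$ on $(\mathbb{R}^{\mathbb{Z}},\mathcal{B}^{\otimes\mathbb{Z}})$ with $Q\{0\}=0$ ($0$ the zero sequence) and $\int(x_0^2\wedge1)\,Q(dx)<\infty$. $\mathbb{P}_Q$ is the distribution of the stationary process $X$ (the IDp process of L\'evy measure $Q$, taken without drift) with $\mathbb{E}[\exp i\langle a,X\rangle]=\exp\int(e^{i\langle a,x\rangle}-1-i\langle c(x),a\rangle)\,Q(dx)$ for all finitely supported $a\in\mathbb{R}^{\mathbb{Z}}$, where $c(x)_i=\max(-1,\min(1,x_i))$. $*$ is convolution (distribution of the sum of independent processes). **Stability.** For $b>0$ let $S_b\{x_n\}_{n\in\mathbb{Z}}=\{bx_n\}_{n\in\mathbb{Z}}$ on $\mathbb{R}^{\mathbb{Z}}$, and let $S_b^\star(Q)$ denote the image of $Q$ under $S_b$. A stationary process is $\alpha$-semi-stable of span $b$ if it is IDp and its L\'evy measure satisfies $Q=b^{-\alpha}S_b^\star(Q)$;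 it is $\alpha$-stable if it is $\alpha$-semi-stable of span $b$ for all $b>0$. (Trivial processes, with $Q=0$, are allowed.) **Canonical factorization.** In $(\mathbb{R}^{\mathbb{Z}},\mathcal{B}^{\otimes\mathbb{Z}},Q,T)$: a set $A$ is wandering if the sets $T^{-n}A$, $n\in\mathbb{Z}$, are disjoint; $\mathfrak{D}$ is the measurable union of all wandering sets and $\mathfrak{C}$ its complement. There is a unique partition (mod $Q$) $\{\mathfrak{P},\mathcal{N}\}$ into $T$-invariant sets such that there is a $T$-invariant probability measure equivalent to $Q_{|\mathfrak{P}}$ (or $Q(\mathfrak{P})=0$) and no $T$-invariant probability measure absolutely continuous with respect to $Q_{|\mathcal{N}}$. There is a partition $\{\mathcal{N}_0,\mathcal{N}_+\}$ into $T$-invariant sets such that $Q(A\cap T^{-k}A)\to0$ as $k\to\infty$ for all $A\subset\mathcal{N}_0$ with $0<Q(A)<\infty$, and $\limsup_{k\to\infty}Q(A\cap T^{-k}A)>0$ for all $A\subset\mathcal{N}_+$ with $Q(A)>0$. Then $Q_B=Q_{|\mathfrak{D}}$, $Q_m=Q_{|\mathcal{N}_0\cap\mathfrak{C}}$, $Q_{wm}=Q_{|\mathcal{N}_+\cap\mathcal{N}}$, $Q_{ne}=Q_{|\mathfrak{P}}$, and $Q=Q_B+Q_m+Q_{wm}+Q_{ne}$. *)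

theory Defs
  imports "HOL-Probability.Probability"
begin

section \<open>Two-sided real sequences\<close>

text \<open>
  A process indexed by the integers is identified with its law on the product space of
  two-sided sequences, on which the coordinates form the canonical process.
\<close>

abbreviation seq_space :: "(int \<Rightarrow> real) measure" where
  "seq_space \<equiv> PiM UNIV (\<lambda>_. borel)"

definition shift :: "int \<Rightarrow> (int \<Rightarrow> real) \<Rightarrow> (int \<Rightarrow> real)" where
  "shift n x = (\<lambda>i. x (i + n))"

definition scale_seq :: "real \<Rightarrow> (int \<Rightarrow> real) \<Rightarrow> (int \<Rightarrow> real)" where
  "scale_seq b x = (\<lambda>i. b * x i)"

definition shift_invariant :: "(int \<Rightarrow> real) measure \<Rightarrow> bool" where
  "shift_invariant M \<longleftrightarrow> distr M seq_space (shift 1) = M"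

text \<open>Intended for finitely supported \<open>a\<close> only.\<close>

definition pairing :: "(int \<Rightarrow> real) \<Rightarrow> (int \<Rightarrow> real) \<Rightarrow> real" where
  "pairing a x = (\<Sum>i\<in>{i. a i \<noteq> 0}. a i * x i)"

definition clip :: "(int \<Rightarrow> real) \<Rightarrow> (int \<Rightarrow> real)" where
  "clip x = (\<lambda>i. max (-1) (min 1 (x i)))"

text \<open>
  Restriction of a measure to a measurable set, kept as a measure on the whole space:
  it maps \<open>B\<close> to \<open>emeasure M (A \<inter> B)\<close>.
\<close>

definition restr :: "'a measure \<Rightarrow> 'a set \<Rightarrow> 'a measure" where
  "restr M A = density M (indicator A)"

definition seq_convolution ::
  "(int \<Rightarrow> real) measure \<Rightarrow> (int \<Rightarrow> real) measure \<Rightarrow> (int \<Rightarrow> real) measure"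
  (infixl "\<star>\<^sub>s" 70) where
  "M \<star>\<^sub>s N = distr (M \<Otimes>\<^sub>M N) seq_space (\<lambda>(x, y) i. x i + y i)"

section \<open>Stationary IDp laws\<close>

definition stationary_levy_measure :: "(int \<Rightarrow> real) measure \<Rightarrow> bool" where
  "stationary_levy_measure Q \<longleftrightarrow>
     sets Q = sets seq_space \<and> sigma_finite_measure Q \<and> shift_invariant Q \<and>
     emeasure Q {\<lambda>_. 0} = 0 \<and>
     (\<integral>\<^sup>+ x. ennreal (min ((x 0)\<^sup>2) 1) \<partial>Q) < \<infinity>"

text \<open>
  \<open>P\<close> is the law of a stationary IDp process without drift whose Levy measure is \<open>Q\<close>.
  The integrand in the exponent is \<open>Q\<close>-integrable by the last condition on a Levy measure
  and shift invariance, so neither Bochner integral takes its default value.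
\<close>

definition is_idp_law_of :: "(int \<Rightarrow> real) measure \<Rightarrow> (int \<Rightarrow> real) measure \<Rightarrow> bool" where
  "is_idp_law_of Q P \<longleftrightarrow>
     stationary_levy_measure Q \<and>
     prob_space P \<and> sets P = sets seq_space \<and> shift_invariant P \<and>
     (\<forall>a. finite {i. a i \<noteq> 0} \<longrightarrow>
        (CLINT x|P. exp (\<i> * complex_of_real (pairing a x))) =
        exp (CLINT x|Q. exp (\<i> * complex_of_real (pairing a x)) - 1
                        - \<i> * complex_of_real (pairing a (clip x))))"

definition idp_law :: "(int \<Rightarrow> real) measure \<Rightarrow> (int \<Rightarrow> real) measure" where
  "idp_law Q = (THE P. is_idp_law_of Q P)"

definition scaling_invariant :: "real \<Rightarrow> real \<Rightarrow> (int \<Rightarrow> real) measure \<Rightarrow> bool" where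
  "scaling_invariant \<alpha> b Q \<longleftrightarrow>
     Q = scale_measure (ennreal (b powr (- \<alpha>))) (distr Q seq_space (scale_seq b))"

text \<open>
  In the next two definitions \<open>P\<close> is the law of the process and \<open>Q\<close> its Levy measure.
\<close>

definition semi_stable_law ::
  "real \<Rightarrow> real \<Rightarrow> (int \<Rightarrow> real) measure \<Rightarrow> (int \<Rightarrow> real) measure \<Rightarrow> bool" where
  "semi_stable_law \<alpha> b Q P \<longleftrightarrow> is_idp_law_of Q P \<and> scaling_invariant \<alpha> b Q"

definition stable_law ::
  "real \<Rightarrow> (int \<Rightarrow> real) measure \<Rightarrow> (int \<Rightarrow> real) measure \<Rightarrow> bool" where
  "stable_law \<alpha> Q P \<longleftrightarrow> (\<forall>b>0. semi_stable_law \<alpha> b Q P)"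

section \<open>The canonical decomposition of a shift-invariant measure\<close>

definition wandering :: "(int \<Rightarrow> real) measure \<Rightarrow> (int \<Rightarrow> real) set \<Rightarrow> bool" where
  "wandering Q A \<longleftrightarrow> A \<in> sets Q \<and> disjoint_family (\<lambda>n. shift n -` A)"

text \<open>
  The measurable union of a family of sets is its least upper bound with respect to
  inclusion modulo null sets; it is determined modulo null sets only.
\<close>

definition is_measurable_union :: "'a measure \<Rightarrow> 'a set set \<Rightarrow> 'a set \<Rightarrow> bool" where
  "is_measurable_union M \<A> U \<longleftrightarrow>
     U \<in> sets M \<and> (\<forall>A\<in>\<A>. A - U \<in> null_sets M) \<and>
     (\<forall>V\<in>sets M. (\<forall>A\<in>\<A>. A - V \<in> null_sets M) \<longrightarrow> U - V \<in> null_sets M)"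

definition is_dissipative_part :: "(int \<Rightarrow> real) measure \<Rightarrow> (int \<Rightarrow> real) set \<Rightarrow> bool" where
  "is_dissipative_part Q D \<longleftrightarrow> is_measurable_union Q {A. wandering Q A} D"

definition invariant_set :: "(int \<Rightarrow> real) measure \<Rightarrow> (int \<Rightarrow> real) set \<Rightarrow> bool" where
  "invariant_set Q A \<longleftrightarrow> A \<in> sets Q \<and> shift 1 -` A = A"

definition invariant_prob :: "(int \<Rightarrow> real) measure \<Rightarrow> bool" where
  "invariant_prob \<nu> \<longleftrightarrow> prob_space \<nu> \<and> sets \<nu> = sets seq_space \<and> shift_invariant \<nu>"

text \<open>Recall that \<open>absolutely_continuous M N\<close> says that \<open>N\<close> is absolutely continuous
  with respect to \<open>M\<close>.\<close>

definition is_positive_null_partition ::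
  "(int \<Rightarrow> real) measure \<Rightarrow> (int \<Rightarrow> real) set \<Rightarrow> (int \<Rightarrow> real) set \<Rightarrow> bool" where
  "is_positive_null_partition Q P N \<longleftrightarrow>
     invariant_set Q P \<and> invariant_set Q N \<and> P \<inter> N = {} \<and> P \<union> N = UNIV \<and>
     (emeasure Q P = 0 \<or>
      (\<exists>\<nu>. invariant_prob \<nu> \<and>
           absolutely_continuous (restr Q P) \<nu> \<and> absolutely_continuous \<nu> (restr Q P))) \<and>
     \<not> (\<exists>\<nu>. invariant_prob \<nu> \<and> absolutely_continuous (restr Q N) \<nu>)"

definition is_zero_type_partition ::
  "(int \<Rightarrow> real) measure \<Rightarrow> (int \<Rightarrow> real) set \<Rightarrow> (int \<Rightarrow> real) set \<Rightarrow> bool" where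
  "is_zero_type_partition Q N0 Np \<longleftrightarrow>
     invariant_set Q N0 \<and> invariant_set Q Np \<and> N0 \<inter> Np = {} \<and> N0 \<union> Np = UNIV \<and>
     (\<forall>A\<in>sets Q. A \<subseteq> N0 \<and> 0 < emeasure Q A \<and> emeasure Q A < \<infinity> \<longrightarrow>
        (\<lambda>k::nat. emeasure Q (A \<inter> shift (int k) -` A)) \<longlonglongrightarrow> 0) \<and>
     (\<forall>A\<in>sets Q. A \<subseteq> Np \<and> 0 < emeasure Q A \<longrightarrow>
        limsup (\<lambda>k::nat. emeasure Q (A \<inter> shift (int k) -` A)) > 0)"

end

theory Submission
  imports Defs
begin

text \<open>
  A scaling \<open>S\<^sub>b\<close> commutes with the shift and maps \<open>Q\<close> to a multiple of itself, so it carries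
  each part of the canonical decomposition to a set with the same defining property. Since such a
  set is unique modulo \<open>Q\<close>, the part is invariant modulo null sets, and the restriction of \<open>Q\<close> to
  it inherits the scaling relation. The four parts cover the space disjointly modulo \<open>Q\<close> because
  wandering sets are of zero type, while no set of positive measure in the positive part is, by
  recurrence of the invariant probability.

  That the laws exist is the Levy--Khintchine theorem on sequence space: cut \<open>Q\<close> into finite
  pieces and sum independent compensated compound Poisson sequences. Laws on sequence space are
  determined by their characteristic functionals, and the exponents of the four parts add up to
  that of \<open>Q\<close>.
\<close>

section \<open>Laws on sequence space and their characteristic functionals\<close>

text \<open>\<open>idp_law\<close> is a definite description, so a claim about a factor has no
  content until a law with the prescribed characteristic functional is known to exist and to be
  unique; a large share of the work goes into this. The law is produced as that of an explicit
  random sequence, which avoids any check of consistency between finite-dimensional distributions.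
  The uniqueness of the parts is used in the form of one-sided inclusions: the difference of a part
  and its preimage under a symmetry is null. This is applied to the symmetry and to its inverse,
  which also multiplies \<open>Q\<close> by a constant, and together they give invariance modulo
  null sets. The shift is treated as one more symmetry, with constant \<open>1\<close>: the
  dissipative part is determined only modulo null sets and need not be strictly
  shift-invariant.\<close>

definition char_fun :: "(int \<Rightarrow> real) measure \<Rightarrow> (int \<Rightarrow> real) \<Rightarrow> complex" where
  "char_fun M a = (CLINT x|M. iexp (pairing a x))"

section \<open>Linear functionals of finitely many coordinates\<close>

lemma pairing_eq_sum:
  assumes "finite J" "\<And>i. i \<notin> J \<Longrightarrow> a i = 0"
  shows "pairing a x = (\<Sum>i\<in>J. a i * x i)"
  unfolding pairing_def using assms by (intro sum.mono_neutral_left) auto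

lemma measurable_pairing [measurable]: "pairing a \<in> borel_measurable seq_space"
  unfolding pairing_def by measurable

lemma pairing_lincomb:
  assumes "finite {i. a i \<noteq> 0}" "finite {i. b i \<noteq> 0}"
  shows "finite {i. r * a i + s * b i \<noteq> 0}"
    and "pairing (\<lambda>i. r * a i + s * b i) x = r * pairing a x + s * pairing b x"
proof -
  let ?J = "{i. a i \<noteq> 0} \<union> {i. b i \<noteq> 0}"
  show "finite {i. r * a i + s * b i \<noteq> 0}"
    by (rule finite_subset[of _ ?J]) (use assms in auto)
  have "pairing (\<lambda>i. r * a i + s * b i) x = (\<Sum>i\<in>?J. (r * a i + s * b i) * x i)"
    using assms by (intro pairing_eq_sum) auto
  moreover have "pairing a x = (\<Sum>i\<in>?J. a i * x i)" "pairing b x = (\<Sum>i\<in>?J. b i * x i)"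
    using assms by (auto intro!: pairing_eq_sum)
  ultimately show "pairing (\<lambda>i. r * a i + s * b i) x = r * pairing a x + s * pairing b x"
    by (simp add: sum.distrib sum_distrib_left algebra_simps)
qed

lemma pairing_single [simp]: "pairing (\<lambda>i. if i = j then t else 0) x = t * x j"
  by (subst pairing_eq_sum[of "{j}"]) auto

lemma finite_support_single [simp]: "finite {i. (if i = (j::int) then t else 0) \<noteq> (0::real)}"
  by (rule finite_subset[of _ "{j}"]) auto

text \<open>The value at \<open>0\<close> is the total mass, so division by one common constant
  makes both measures probabilities, to which Levy's uniqueness theorem applies. Vanishing mass
  cannot be normalised and is treated apart.\<close>

lemma finite_measure_eqI_char:
  assumes M: "finite_measure M" "sets M = sets borel"
    and N: "finite_measure N" "sets N = sets borel"
    and eq: "\<And>t. char M t = char N t"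
  shows "M = N"
proof -
  interpret M: finite_measure M by fact
  interpret N: finite_measure N by fact
  note [measurable_cong] = M(2) N(2)
  have sp: "space M = UNIV" "space N = UNIV"
    using M(2) N(2) by (auto dest: sets_eq_imp_space_eq)
  have m: "measure M UNIV = measure N UNIV"
    using eq[of 0] by (simp add: char_def sp)
  show ?thesis
  proof (cases "measure M UNIV = 0")
    case True
    have "emeasure M A = emeasure N A" for A
    proof -
      have "emeasure M A \<le> emeasure M UNIV" "emeasure N A \<le> emeasure N UNIV"
        using emeasure_space[of M A] emeasure_space[of N A] by (auto simp: sp)
      with True m show ?thesis
        by (simp add: M.emeasure_eq_measure N.emeasure_eq_measure)
    qed
    then show ?thesis using M(2) N(2) by (intro measure_eqI) auto
  next
    case False
    define c where "c = 1 / measure M UNIV"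
    have c: "c > 0" using False unfolding c_def by (simp add: zero_less_measure_iff)
    have real_distr: "real_distribution (density L (\<lambda>_. ennreal c))"
      if "finite_measure L" "sets L = sets borel" "measure L UNIV = measure M UNIV" for L
    proof -
      interpret L: finite_measure L by fact
      have "space L = UNIV" using that(2) by (auto dest: sets_eq_imp_space_eq)
      moreover have "ennreal c * ennreal (measure L UNIV) = 1"
        using False by (simp add: c_def that(3) flip: ennreal_mult')
      ultimately have "prob_space (density L (\<lambda>_. ennreal c))"
        by (intro prob_spaceI, subst emeasure_density_const) (auto simp: L.emeasure_eq_measure that(2))
      then show ?thesis using that(2) \<open>space L = UNIV\<close>
        by (simp add: real_distribution_def real_distribution_axioms_def)
    qed
    have "char (density M (\<lambda>_. ennreal c)) = char (density N (\<lambda>_. ennreal c))"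
    proof
      fix t
      have d: "char (density L (\<lambda>_. ennreal c)) t = c *\<^sub>R char L t" if "sets L = sets borel" for L
        unfolding char_def using c that
        by (subst integral_density) (auto cong: measurable_cong_sets)
      show "char (density M (\<lambda>_. ennreal c)) t = char (density N (\<lambda>_. ennreal c)) t"
        unfolding d[OF M(2)] d[OF N(2)] eq by (rule refl)
    qed
    with real_distr[OF M refl] real_distr[OF N m[symmetric]]
    have *: "density M (\<lambda>_. ennreal c) = density N (\<lambda>_. ennreal c)"
      by (rule Levy_uniqueness)
    show ?thesis
    proof (rule measure_eqI)
      fix A assume A: "A \<in> sets M"
      have "emeasure (density M (\<lambda>_. ennreal c)) A = emeasure (density N (\<lambda>_. ennreal c)) A"
        by (simp add: *)
      then have "ennreal c * emeasure M A = ennreal c * emeasure N A"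
        using A M(2) N(2) by (simp add: emeasure_density_const)
      then show "emeasure M A = emeasure N A" using c
        by (simp add: ennreal_mult_cancel_left)
    qed (simp add: M N)
  qed
qed

text \<open>
  Reduction to one dimension: weighting by \<open>1 + Re (u \<cdot> exp (i\<langle>a,x\<rangle>)) \<ge> 0\<close> turns the
  complex measures that arise when the coordinates are treated one after the other into
  positive ones, to which Levy's theorem on the line applies.
\<close>

lemma cylinder_char_fun_eq:
  assumes M: "prob_space M" "sets M = sets seq_space"
    and N: "prob_space N" "sets N = sets seq_space"
    and eq: "\<And>a. finite {i. a i \<noteq> 0} \<Longrightarrow> char_fun M a = char_fun N a"
    and K: "finite K" and B: "\<And>i. i \<in> K \<Longrightarrow> B i \<in> sets borel"
    and a: "finite {i. a i \<noteq> 0}"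
  shows "(CLINT x|M. of_real (\<Prod>i\<in>K. indicator (B i) (x i)) * iexp (pairing a x)) =
         (CLINT x|N. of_real (\<Prod>i\<in>K. indicator (B i) (x i)) * iexp (pairing a x))"
  using K B a
proof (induction K arbitrary: a)
  case empty
  then show ?case using eq[of a] by (simp add: char_fun_def)
next
  case (insert j K)
  define h :: "(int \<Rightarrow> real) \<Rightarrow> real" where "h x = (\<Prod>i\<in>K. indicator (B i) (x i))" for x
  have [measurable]: "B i \<in> sets borel" if "i \<in> insert j K" for i
    using insert that by auto
  have h_meas[measurable]: "h \<in> borel_measurable seq_space"
    unfolding h_def[abs_def] by measurable
  have h: "0 \<le> h x" "h x \<le> 1" for x
    unfolding h_def by (auto intro!: prod_nonneg prod_le_1)
  have IH: "(CLINT x|M. of_real (h x) * iexp (pairing a x)) =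
            (CLINT x|N. of_real (h x) * iexp (pairing a x))" if "finite {i. a i \<noteq> 0}" for a
    unfolding h_def using insert that by auto
  \<comment> \<open>Any \<open>u\<close> in the closed unit disc keeps the weight nonnegative. The
    proof ends with \<open>u = 0\<close>, which gives back \<open>h\<close>, and with
    \<open>u = 1\<close> and \<open>u = - \<i>\<close>, which read off a real and an imaginary
    part.\<close>
  define w where "w u x = h x * (1 + Re (u * iexp (pairing a x)))" for u x
  have w_meas[measurable]: "w u \<in> borel_measurable seq_space" for u
    unfolding w_def[abs_def] by measurable
  have abs_Re: "\<bar>Re (u * iexp y)\<bar> \<le> 1" if "norm u \<le> 1" for u y
    using abs_Re_le_cmod[of "u * iexp y"] that by (simp add: norm_mult)
  have w: "0 \<le> w u x" "w u x \<le> 2" if "norm u \<le> 1" for u x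
  proof -
    have *: "\<bar>Re (u * iexp (pairing a x))\<bar> \<le> 1" by (rule abs_Re[OF that])
    show "0 \<le> w u x" unfolding w_def by (rule mult_nonneg_nonneg) (use h[of x] * in linarith)+
    have "w u x \<le> 1 * 2" unfolding w_def
      by (rule mult_mono) (use h[of x] * in linarith)+
    then show "w u x \<le> 2" by simp
  qed
  have Bj[measurable]: "B j \<in> sets borel" using insert by auto
  define \<mu> where "\<mu> L u = distr (density L (\<lambda>x. ennreal (w u x))) borel (\<lambda>x. x j)" for L u
  have \<mu>_eq: "\<mu> M u = \<mu> N u" if u: "norm u \<le> 1" for u
  proof (rule finite_measure_eqI_char)
    have fin: "finite_measure (\<mu> L u)" if L: "prob_space L" "sets L = sets seq_space" for L
    proof -
      interpret prob_space L by fact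
      note [measurable_cong] = L(2)
      have "(\<integral>\<^sup>+x. ennreal (w u x) \<partial>L) \<le> (\<integral>\<^sup>+x. 2 \<partial>L)"
        using w[OF u] by (intro nn_integral_mono) (auto simp flip: ennreal_numeral intro!: ennreal_leI)
      also have "\<dots> < \<infinity>" by (simp add: emeasure_space_1)
      finally show ?thesis unfolding \<mu>_def
        by (intro finite_measure.finite_measure_distr finite_measureI)
           (auto simp: emeasure_density cong: nn_integral_cong)
    qed
    show "finite_measure (\<mu> M u)" "finite_measure (\<mu> N u)" using fin M N by auto
    show "sets (\<mu> M u) = sets borel" "sets (\<mu> N u) = sets borel" by (auto simp: \<mu>_def)
    fix t
    let ?e = "\<lambda>i. if i = j then 1 else 0 :: real"
    let ?I = "\<lambda>L s. CLINT x|L. of_real (h x) * iexp (pairing (\<lambda>i. s * a i + t * ?e i) x)"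
    \<comment> \<open>By \<open>Re z = (z + cnj z) / 2\<close> only the frequencies
      \<open>s * a\<close> plus \<open>t\<close> at place \<open>j\<close>, with \<open>s\<close>
      among \<open>0\<close>, \<open>1\<close> and \<open>-1\<close>, occur; the induction
      hypothesis covers all of them.\<close>
    have C: "char (\<mu> L u) t = ?I L 0 + (u / 2 * ?I L 1 + cnj u / 2 * ?I L (-1))"
      if L: "prob_space L" "sets L = sets seq_space" for L
    proof -
      interpret prob_space L by fact
      note [measurable_cong] = L(2)
      have pl: "pairing (\<lambda>i. s * a i + t * ?e i) x = s * pairing a x + t * x j" for s x
        using pairing_lincomb(2)[of a ?e s t x] insert.prems by simp
      have int: "integrable L (\<lambda>x. of_real (h x) * iexp (s * pairing a x + t * x j))" for s
        by (rule integrable_const_bound[of _ 1]) (use h in \<open>auto simp: norm_mult\<close>)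
      have "char (\<mu> L u) t = (CLINT x|L. of_real (w u x) * iexp (t * x j))"
        unfolding char_def \<mu>_def using w[OF u]
        by (subst integral_distr, simp, simp, subst integral_density) (auto simp: scaleR_conv_of_real)
      also have "\<dots> = (CLINT x|L. of_real (h x) * iexp (0 * pairing a x + t * x j) +
           (u / 2 * (of_real (h x) * iexp (1 * pairing a x + t * x j)) +
            cnj u / 2 * (of_real (h x) * iexp (-1 * pairing a x + t * x j))))"
      proof (rule Bochner_Integration.integral_cong[OF refl])
        fix x
        have "of_real (Re (u * iexp (pairing a x))) =
           (u * iexp (pairing a x) + cnj u * iexp (- pairing a x)) / 2"
          using complex_add_cnj[of "u * iexp (pairing a x)"] by (simp add: exp_cnj)
        moreover have "iexp (0 * pairing a x + t * x j) = iexp (t * x j)"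
          "iexp (1 * pairing a x + t * x j) = iexp (pairing a x) * iexp (t * x j)"
          "iexp (-1 * pairing a x + t * x j) = iexp (- pairing a x) * iexp (t * x j)"
          by (simp_all add: algebra_simps flip: exp_add)
        ultimately show "complex_of_real (w u x) * iexp (t * x j) =
           of_real (h x) * iexp (0 * pairing a x + t * x j) +
           (u / 2 * (of_real (h x) * iexp (1 * pairing a x + t * x j)) +
            cnj u / 2 * (of_real (h x) * iexp (-1 * pairing a x + t * x j)))"
          by (simp only: w_def of_real_mult of_real_add of_real_1) (simp add: field_simps)
      qed
      also have "\<dots> = ?I L 0 + (u / 2 * ?I L 1 + cnj u / 2 * ?I L (-1))"
        unfolding pl using int[of 0] int[of 1] int[of "-1"]
        by (simp add: integral_add integrable_add)
      finally show ?thesis .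
    qed
    have "?I M s = ?I N s" for s
      by (rule IH) (use pairing_lincomb(1)[of a ?e s t] insert.prems in simp)
    then show "char (\<mu> M u) t = char (\<mu> N u) t" unfolding C[OF M] C[OF N] by (simp only:)
  qed
  let ?g = "\<lambda>x. indicator (B j) (x j) * h x"
  have w_int: "(LINT x|M. indicator (B j) (x j) * w u x) = (LINT x|N. indicator (B j) (x j) * w u x)"
    if u: "norm u \<le> 1" for u
  proof -
    have m: "measure (\<mu> L u) (B j) = (LINT x|L. indicator (B j) (x j) * w u x)"
      if L: "prob_space L" "sets L = sets seq_space" for L
    proof -
      interpret prob_space L by fact
      note [measurable_cong] = L(2)
      have "measure (\<mu> L u) (B j) = (LINT y|\<mu> L u. indicator (B j) y)" by (simp add: \<mu>_def)
      also have "\<dots> = (LINT x|L. indicator (B j) (x j) * w u x)"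
        unfolding \<mu>_def using w[OF u]
        by (subst integral_distr, simp, simp, subst integral_density) (auto simp: mult.commute)
      finally show ?thesis .
    qed
    show ?thesis using \<mu>_eq[OF u] by (simp only: m[OF M, symmetric] m[OF N, symmetric])
  qed
  have expand: "(LINT x|L. indicator (B j) (x j) * w u x) =
      (LINT x|L. ?g x) + (LINT x|L. Re (u * (of_real (?g x) * iexp (pairing a x))))"
    and int: "integrable L (\<lambda>x. of_real (?g x) * iexp (pairing a x))"
    if L: "prob_space L" "sets L = sets seq_space" and u: "norm u \<le> 1" for L u
  proof -
    interpret prob_space L by fact
    note [measurable_cong] = L(2)
    have g: "\<bar>?g x\<bar> \<le> 1" for x using h[of x] by (auto simp: indicator_def)
    have 1: "integrable L ?g"
      by (rule integrable_const_bound[of _ 1]) (use g in auto)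
    show 2: "integrable L (\<lambda>x. of_real (?g x) * iexp (pairing a x))"
      by (rule integrable_const_bound[of _ 1]) (use g in \<open>auto simp: norm_mult abs_mult\<close>)
    have "integrable L (\<lambda>x. Re (u * (of_real (?g x) * iexp (pairing a x))))"
      using 2 by (intro integrable_Re integrable_mult_right)
    note Bochner_Integration.integral_add[OF 1 this, symmetric]
    moreover have "indicator (B j) (x j) * w u x =
        ?g x + Re (u * (of_real (?g x) * iexp (pairing a x)))" for x
    proof -
      have "u * (of_real (?g x) * iexp (pairing a x)) = of_real (?g x) * (u * iexp (pairing a x))"
        by (simp only: ac_simps)
      moreover have "Re (of_real r * z) = r * Re z" for r z by simp
      ultimately show ?thesis by (simp only: w_def) (simp only: distrib_left mult_1_right mult.assoc)
    qed
    ultimately show "(LINT x|L. indicator (B j) (x j) * w u x) =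
      (LINT x|L. ?g x) + (LINT x|L. Re (u * (of_real (?g x) * iexp (pairing a x))))"
      by simp
  qed
  let ?J = "\<lambda>L. CLINT x|L. of_real (?g x) * iexp (pairing a x)"
  have Re_eq: "Re (u * ?J M) = Re (u * ?J N)" if u: "norm u \<le> 1" for u
  proof -
    have J: "Re (u * ?J L) = (LINT x|L. Re (u * (of_real (?g x) * iexp (pairing a x))))"
      if L: "prob_space L" "sets L = sets seq_space" for L
    proof -
      note i = int[OF L u]
      have "u * ?J L = (CLINT x|L. u * (of_real (?g x) * iexp (pairing a x)))"
        by (rule integral_mult_right_zero[symmetric])
      with integral_Re[OF integrable_mult_right[OF i, of u]] show ?thesis by simp
    qed
    have "(LINT x|M. ?g x) = (LINT x|N. ?g x)"
      using expand[OF M, of 0] expand[OF N, of 0] w_int[of 0] by simp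
    with expand[OF M u] expand[OF N u] w_int[OF u] show ?thesis
      unfolding J[OF M] J[OF N] by linarith
  qed
  have "?J M = ?J N"
    using Re_eq[of 1] Re_eq[of "- \<i>"] by (intro complex_eqI) auto
  then show ?case using insert.hyps by (simp add: h_def)
qed

text \<open>At frequency zero, \<open>cylinder_char_fun_eq\<close> compares the probabilities of
  finite-dimensional cylinders, and these determine a law on the product space.\<close>

lemma char_fun_unique:
  assumes M: "prob_space M" "sets M = sets seq_space"
    and N: "prob_space N" "sets N = sets seq_space"
    and eq: "\<And>a. finite {i. a i \<noteq> 0} \<Longrightarrow> char_fun M a = char_fun N a"
  shows "M = N"
proof (rule measure_eqI_PiM_infinite[OF M(2) N(2)])
  interpret M: prob_space M by fact
  interpret N: prob_space N by fact
  show "finite_measure M" by unfold_locales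
  fix B :: "int \<Rightarrow> real set" and J :: "int set"
  assume J: "finite J" and B: "\<And>i. i \<in> J \<Longrightarrow> B i \<in> sets borel"
  let ?X = "prod_emb UNIV (\<lambda>_. borel) J (Pi\<^sub>E J B)"
  have X[measurable]: "?X \<in> sets seq_space" using J B by (intro sets_PiM_I) auto
  have ind: "(\<Prod>i\<in>J. indicator (B i) (x i)) = (indicator ?X x :: real)" for x
  proof (cases "\<forall>i\<in>J. x i \<in> B i")
    case True
    then show ?thesis by (simp add: prod_emb_def space_PiM PiE_def)
  next
    case False
    then have "(\<Prod>i\<in>J. indicator (B i) (x i)) = (0 :: real)"
      using J by (auto simp: indicator_eq_0_iff)
    moreover have "x \<notin> ?X" using False by (auto simp: prod_emb_def)
    ultimately show ?thesis by simp
  qed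
  have I: "(CLINT x|L. of_real (\<Prod>i\<in>J. indicator (B i) (x i)) * iexp (pairing (\<lambda>_. 0) x))
      = of_real (measure L ?X)" if "prob_space L" "sets L = sets seq_space" for L
  proof -
    have "space L = UNIV" using that(2) by (auto dest: sets_eq_imp_space_eq simp: space_PiM)
    then show ?thesis unfolding ind by (simp add: pairing_def integral_of_real)
  qed
  have "(CLINT x|M. of_real (\<Prod>i\<in>J. indicator (B i) (x i)) * iexp (pairing (\<lambda>_. 0) x)) =
      (CLINT x|N. of_real (\<Prod>i\<in>J. indicator (B i) (x i)) * iexp (pairing (\<lambda>_. 0) x))"
    by (rule cylinder_char_fun_eq[OF M N eq J B]) auto
  then have "complex_of_real (measure M ?X) = of_real (measure N ?X)"
    unfolding I[OF M] I[OF N] .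
  then have "measure M ?X = measure N ?X" by simp
  then show "emeasure M ?X = emeasure N ?X"
    by (simp add: M.emeasure_eq_measure N.emeasure_eq_measure)
qed

section \<open>Sums of independent random sequences\<close>

lemma indep_vars_PiM_coordinates:
  assumes "\<And>k::nat. prob_space (M k)"
  shows "prob_space.indep_vars (PiM UNIV M) M (\<lambda>k \<omega>. \<omega> k) UNIV"
proof -
  interpret product_prob_space M UNIV
    by (rule product_prob_spaceI) (rule assms)
  show ?thesis
    by (subst indep_vars_iff_distr_eq_PiM') (auto simp: PiM_component restrict_UNIV)
qed

lemma char_fun_sum_PiM:
  assumes M: "\<And>k::nat. prob_space (M k)" "\<And>k. sets (M k) = sets seq_space"
  shows "(CLINT \<omega>|PiM UNIV M. iexp (\<Sum>k<n. pairing a (\<omega> k))) = (\<Prod>k<n. char_fun (M k) a)"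
proof -
  interpret product_prob_space M UNIV
    by (rule product_prob_spaceI) (rule M(1))
  note [measurable_cong] = M(2)
  have "indep_vars M (\<lambda>k \<omega>. \<omega> k) {..<n}"
    by (rule indep_vars_subset[OF indep_vars_PiM_coordinates[OF M(1)]]) simp
  then have ind: "indep_vars (\<lambda>_. borel) (\<lambda>k \<omega>. iexp (pairing a (\<omega> k))) {..<n}"
    by (rule indep_vars_compose2) measurable
  have "(CLINT \<omega>|PiM UNIV M. iexp (\<Sum>k<n. pairing a (\<omega> k))) =
        (CLINT \<omega>|PiM UNIV M. (\<Prod>k<n. iexp (pairing a (\<omega> k))))"
    by (simp add: exp_sum sum_distrib_left)
  also have "\<dots> = (\<Prod>k<n. CLINT \<omega>|PiM UNIV M. iexp (pairing a (\<omega> k)))"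
    by (rule indep_vars_lebesgue_integral[OF _ ind])
       (auto intro!: integrable_const_bound[of _ 1])
  also have "\<dots> = (\<Prod>k<n. char_fun (M k) a)"
  proof (rule prod.cong[OF refl])
    fix k
    have "char_fun (M k) a = char_fun (distr (PiM UNIV M) (M k) (\<lambda>\<omega>. \<omega> k)) a"
      by (simp add: PiM_component)
    then show "(CLINT \<omega>|PiM UNIV M. iexp (pairing a (\<omega> k))) = char_fun (M k) a"
      by (simp add: char_fun_def integral_distr)
  qed
  finally show ?thesis .
qed

section \<open>Existence of IDp laws\<close>

definition lk_integrand :: "(int \<Rightarrow> real) \<Rightarrow> (int \<Rightarrow> real) \<Rightarrow> complex" where
  "lk_integrand a x = iexp (pairing a x) - 1 - \<i> * complex_of_real (pairing a (clip x))"

lemma measurable_clip [measurable]: "clip \<in> measurable seq_space seq_space"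
  unfolding clip_def by (rule measurable_abs_UNIV) measurable

lemma measurable_lk [measurable]: "lk_integrand a \<in> borel_measurable seq_space"
  unfolding lk_integrand_def[abs_def] by measurable

lemma norm_iexp [simp]: "norm (exp (\<i> * complex_of_real y)) = 1"
  by simp

lemma min_square_one_ge: "\<bar>y\<bar> \<le> 1 \<Longrightarrow> min (y\<^sup>2) 1 = y\<^sup>2" for y :: real
  by (simp add: abs_square_le_1 min_absorb1)

text \<open>If the coordinates seen by \<open>a\<close> are all at most \<open>1\<close> in modulus,
  \<open>clip\<close> does not change them and the second-order Taylor bound applies, with
  \<open>\<bar>pairing a x\<bar> \<le> A * sqrt m\<close>, where \<open>m\<close> is the sum on the
  right. Otherwise \<open>m\<close> is at least \<open>1\<close> and the trivial bound
  \<open>2 + A\<close> suffices. The constant adds up both cases.\<close>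

lemma norm_lk_le:
  assumes a: "finite {i. a i \<noteq> 0}"
  defines "A \<equiv> \<Sum>i\<in>{i. a i \<noteq> 0}. \<bar>a i\<bar>"
  shows "norm (lk_integrand a x) \<le> (2 + A + A\<^sup>2) * (\<Sum>i\<in>{i. a i \<noteq> 0}. min ((x i)\<^sup>2) 1)"
proof -
  let ?J = "{i. a i \<noteq> 0}"
  define m where "m = (\<Sum>i\<in>?J. min ((x i)\<^sup>2) 1)"
  have A0: "A \<ge> 0" unfolding A_def by (rule sum_nonneg) simp
  have m0: "m \<ge> 0" unfolding m_def by (rule sum_nonneg) simp
  have mi: "min ((x i)\<^sup>2) 1 \<le> m" if "i \<in> ?J" for i
    unfolding m_def using a that by (intro member_le_sum) auto
  have "norm (lk_integrand a x) \<le> (2 + A + A\<^sup>2) * m"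
  proof (cases "\<forall>i\<in>?J. \<bar>x i\<bar> \<le> 1")
    case True
    have "pairing a (clip x) = pairing a x"
      unfolding pairing_def using True by (intro sum.cong) (auto simp: clip_def min_def max_def abs_le_iff)
    then have "norm (lk_integrand a x) \<le> \<bar>pairing a x\<bar>\<^sup>2 / 2"
      using iexp_approx1[of "pairing a x" 1] by (simp add: lk_integrand_def diff_diff_eq numeral_2_eq_2)
    also have "\<bar>pairing a x\<bar> \<le> (\<Sum>i\<in>?J. \<bar>a i\<bar> * sqrt m)"
      unfolding pairing_def
    proof (rule order_trans[OF sum_abs], rule sum_mono)
      fix i assume i: "i \<in> ?J"
      have "(x i)\<^sup>2 \<le> m" using mi[OF i] True i min_square_one_ge by auto
      then have "\<bar>x i\<bar> \<le> sqrt m" using real_le_rsqrt by auto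
      then show "\<bar>a i * x i\<bar> \<le> \<bar>a i\<bar> * sqrt m" by (simp add: abs_mult mult_left_mono)
    qed
    then have "\<bar>pairing a x\<bar>\<^sup>2 / 2 \<le> (A * sqrt m)\<^sup>2 / 2"
      by (intro divide_right_mono power_mono) (auto simp: A_def sum_distrib_right)
    also have "\<dots> \<le> A\<^sup>2 * m" using m0 by (simp add: power_mult_distrib)
    also have "\<dots> \<le> (2 + A + A\<^sup>2) * m" using m0 A0 by (intro mult_right_mono) auto
    finally show ?thesis .
  next
    case False
    then obtain i where i: "i \<in> ?J" "\<bar>x i\<bar> > 1" by force
    then have "1 \<le> (x i)\<^sup>2" using one_le_power[of "\<bar>x i\<bar>" 2] by simp
    with mi[OF i(1)] have m1: "1 \<le> m" by simp
    have "\<bar>pairing a (clip x)\<bar> \<le> A"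
      unfolding pairing_def A_def
    proof (rule order_trans[OF sum_abs], rule sum_mono)
      fix i
      have "\<bar>clip x i\<bar> \<le> 1" by (auto simp: clip_def)
      then show "\<bar>a i * clip x i\<bar> \<le> \<bar>a i\<bar>" by (simp add: abs_mult mult_left_le)
    qed
    moreover have "norm (lk_integrand a x) \<le> norm (iexp (pairing a x)) + 1 + \<bar>pairing a (clip x)\<bar>"
      unfolding lk_integrand_def
      by (rule order_trans[OF norm_triangle_ineq4] add_mono order_trans[OF norm_triangle_ineq4])+
         (simp_all add: norm_mult)
    ultimately have "norm (lk_integrand a x) \<le> (2 + A + A\<^sup>2) * 1"
      unfolding norm_iexp using zero_le_power2[of A] by argo
    also have "\<dots> \<le> (2 + A + A\<^sup>2) * m" using m1 A0 by (intro mult_left_mono) auto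
    finally show ?thesis .
  qed
  then show ?thesis by (simp add: m_def)
qed

text \<open>The linear term is absorbed by \<open>\<bar>t\<bar> \<le> 1 + t^2\<close>, so that
  averaging over a Gaussian frequency in \<open>tail_le_char\<close> needs no moment beyond the
  second.\<close>

lemma norm_lk_single_le:
  "norm (lk_integrand (\<lambda>i. if i = j then t else 0) x) \<le> (3 + 2 * t\<^sup>2) * min ((x j)\<^sup>2) 1"
proof (cases "t = 0")
  case True
  then show ?thesis by (simp add: lk_integrand_def)
next
  case False
  then have *: "{i. (if i = j then t else 0) \<noteq> 0} = {j}" by auto
  have "\<bar>t\<bar> \<le> 1 + t\<^sup>2"
    using zero_le_power2[of "\<bar>t\<bar> - 1"] by (simp add: power2_diff)
  then have "(2 + \<bar>t\<bar> + t\<^sup>2) * min ((x j)\<^sup>2) 1 \<le> (3 + 2 * t\<^sup>2) * min ((x j)\<^sup>2) 1"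
    by (intro mult_right_mono) auto
  with norm_lk_le[of "\<lambda>i. if i = j then t else 0" x] * show ?thesis by simp
qed

text \<open>
  The integral of \<open>1 - char M (s y)\<close> against a Gaussian \<open>y\<close> is the \<open>M\<close>-mean
  of \<open>1 - exp (- (s x)\<^sup>2 / 2)\<close>, which is at least \<open>1/2\<close> where \<open>\<bar>x\<bar> \<ge> 2 / s\<close>.
\<close>

lemma (in real_distribution) tail_le_char:
  assumes char: "\<And>t. norm (1 - char M t) \<le> (3 + 2 * t\<^sup>2) * \<epsilon>" and \<delta>: "\<delta> > 0"
  shows "prob {x. \<delta> \<le> \<bar>x\<bar>} \<le> (6 + 16 / \<delta>\<^sup>2) * \<epsilon>"
proof -
  define s where "s = 2 / \<delta>"
  define G where "G = std_normal_distribution"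
  interpret G: real_distribution G unfolding G_def by (rule real_dist_normal_dist)
  interpret GM: pair_prob_space G M ..
  have mom: "integrable G (\<lambda>y. y\<^sup>2)" "(LINT y|G. y\<^sup>2) = 1"
    using std_normal_distribution_even_moments[of 1] by (simp_all add: G_def fact_numeral)
  have int: "integrable (G \<Otimes>\<^sub>M M) (\<lambda>(y, x). iexp (s * y * x))"
    by (rule GM.integrable_const_bound[of _ 1]) auto
  let ?f = "\<lambda>x. 1 - exp (- (s * x)\<^sup>2 / 2)"
  have f_int: "integrable M ?f"
    by (rule integrable_const_bound[of _ 1]) auto
  have "(CLINT x|M. of_real (?f x)) = (CLINT x|M. 1 - (CLINT y|G. iexp (s * y * x)))"
  proof (rule Bochner_Integration.integral_cong[OF refl])
    fix x
    have "(CLINT y|G. iexp (s * y * x)) = char G (s * x)"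
      by (simp add: char_def ac_simps)
    also have "\<dots> = of_real (exp (- (s * x)\<^sup>2 / 2))"
      by (simp add: G_def char_std_normal_distribution)
    finally show "complex_of_real (?f x) = 1 - (CLINT y|G. iexp (s * y * x))"
      by simp
  qed
  also have "\<dots> = 1 - (CLINT x|M. CLINT y|G. iexp (s * y * x))"
    using GM.integrable_snd[OF int] by (subst Bochner_Integration.integral_diff) (auto simp: prob_space simp del: space_eq_univ)
  also have "(CLINT x|M. CLINT y|G. iexp (s * y * x)) = (CLINT y|G. CLINT x|M. iexp (s * y * x))"
    by (rule GM.Fubini_integral[OF int])
  also have "\<dots> = (CLINT y|G. char M (s * y))" by (simp add: char_def)
  also have "1 - \<dots> = (CLINT y|G. 1 - char M (s * y))"
    by (subst Bochner_Integration.integral_diff)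
       (auto simp: G.prob_space simp del: G.space_eq_univ intro!: G.integrable_const_bound[of _ 1] cmod_char_le_1)
  finally have "norm (CLINT x|M. of_real (?f x)) \<le> (LINT y|G. norm (1 - char M (s * y)))"
    by (simp add: integral_norm_bound)
  also have "\<dots> \<le> (LINT y|G. 3 * \<epsilon> + 2 * s\<^sup>2 * \<epsilon> * y\<^sup>2)"
  proof (rule integral_mono)
    have "norm (1 - char M t) \<le> 2" for t
      by (rule order_trans[OF norm_triangle_ineq4]) (use cmod_char_le_1[of t] in simp)
    then show "integrable G (\<lambda>y. norm (1 - char M (s * y)))"
      by (intro G.integrable_const_bound[of _ 2]) auto
    show "integrable G (\<lambda>y. 3 * \<epsilon> + 2 * s\<^sup>2 * \<epsilon> * y\<^sup>2)" using mom(1) by auto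
    show "norm (1 - char M (s * y)) \<le> 3 * \<epsilon> + 2 * s\<^sup>2 * \<epsilon> * y\<^sup>2" for y
      using char[of "s * y"] by (simp add: algebra_simps power_mult_distrib)
  qed
  also have "\<dots> = 3 * \<epsilon> + 2 * s\<^sup>2 * \<epsilon>"
    using mom by (simp add: G.prob_space del: G.space_eq_univ)
  also have "norm (CLINT x|M. of_real (?f x)) = \<bar>LINT x|M. ?f x\<bar>"
    by (subst integral_of_real[OF f_int]) (rule norm_of_real)
  finally have upper: "(LINT x|M. ?f x) \<le> 3 * \<epsilon> + 2 * s\<^sup>2 * \<epsilon>" by simp
  have "prob {x. \<delta> \<le> \<bar>x\<bar>} / 2 = (LINT x|M. indicator {x. \<delta> \<le> \<bar>x\<bar>} x / 2)" by simp
  also have "\<dots> \<le> (LINT x|M. ?f x)"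
  proof (rule integral_mono[OF _ f_int])
    show "integrable M (\<lambda>x. indicator {x. \<delta> \<le> \<bar>x\<bar>} x / 2 :: real)"
      by (rule integrable_const_bound[of _ 1]) (auto simp: indicator_def)
    fix x
    have "?f x \<ge> 1 / 2" if x: "\<delta> \<le> \<bar>x\<bar>"
    proof -
      have "2 \<le> \<bar>s * x\<bar>" using x \<delta> by (simp add: s_def abs_mult field_simps)
      then have "2\<^sup>2 \<le> (s * x)\<^sup>2" using power_mono[of 2 "\<bar>s * x\<bar>" 2] by simp
      moreover have "exp (2::real) \<ge> 2" using exp_ge_add_one_self[of 2] by simp
      then have "exp (- 2 :: real) \<le> 1 / 2" by (simp add: exp_minus field_simps)
      moreover have "exp (- (s * x)\<^sup>2 / 2) \<le> exp (- 2)" using calculation(1) by simp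
      ultimately show ?thesis by linarith
    qed
    then show "indicator {x. \<delta> \<le> \<bar>x\<bar>} x / 2 \<le> ?f x" by (auto simp: indicator_def)
  qed
  finally have "prob {x. \<delta> \<le> \<bar>x\<bar>} \<le> 2 * (3 * \<epsilon> + 2 * s\<^sup>2 * \<epsilon>)" using upper by argo
  also have "\<dots> = (6 + 16 / \<delta>\<^sup>2) * \<epsilon>" by (simp add: s_def power_divide algebra_simps)
  finally show ?thesis .
qed

text \<open>The generating function of the Poisson distribution. Taken at the characteristic
  functional of the jump law, it yields that of a compound Poisson sum.\<close>

lemma integral_poisson_pmf_power:
  assumes r: "0 < r" and z: "norm z \<le> 1"
  shows "(CLINT n|measure_pmf (poisson_pmf r). z ^ n) = exp (of_real r * (z - 1))"
proof -
  have int: "integrable (measure_pmf (poisson_pmf r)) (\<lambda>n. z ^ n)"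
    by (rule measure_pmf.integrable_const_bound[of _ 1])
       (auto simp: norm_power power_le_one z)
  let ?g = "\<lambda>n. pmf (poisson_pmf r) n *\<^sub>R z ^ n"
  have "integrable (count_space UNIV) ?g"
    using int unfolding measure_pmf_eq_density by (subst (asm) integrable_density) auto
  then have "?g sums (integral\<^sup>L (count_space UNIV) ?g)"
    by (rule sums_integral_count_space_nat)
  moreover have "integral\<^sup>L (count_space UNIV) ?g = (CLINT n|measure_pmf (poisson_pmf r). z ^ n)"
    unfolding measure_pmf_eq_density by (subst integral_density) auto
  moreover have "?g sums (exp (of_real r * z) * of_real (exp (- r)))"
  proof -
    have "(\<lambda>n. (of_real r * z) ^ n /\<^sub>R fact n * of_real (exp (- r))) sums (exp (of_real r * z) * of_real (exp (- r)))"
      by (intro sums_mult2 exp_converges)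
    then show ?thesis using r
      by (simp add: scaleR_conv_of_real power_mult_distrib field_simps)
  qed
  ultimately have "(CLINT n|measure_pmf (poisson_pmf r). z ^ n) = exp (of_real r * z) * of_real (exp (- r))"
    using sums_unique2 by metis
  then show ?thesis
    by (simp add: right_diff_distrib exp_diff exp_minus exp_of_real field_simps)
qed

section \<open>Restricted measures and compound Poisson laws\<close>

lemma space_restr [simp]: "space (restr M A) = space M"
  and sets_restr [simp, measurable_cong]: "sets (restr M A) = sets M"
  by (simp_all add: restr_def)

lemma emeasure_restr:
  assumes "A \<in> sets M" "B \<in> sets M"
  shows "emeasure (restr M A) B = emeasure M (A \<inter> B)"
  using assms by (simp add: restr_def emeasure_restricted)

lemma nn_integral_restr:
  assumes "A \<in> sets M" "f \<in> borel_measurable M"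
  shows "(\<integral>\<^sup>+x. f x \<partial>restr M A) = (\<integral>\<^sup>+x. indicator A x * f x \<partial>M)"
  using assms by (simp add: restr_def nn_integral_density)

lemma integral_restr:
  fixes f :: "'a \<Rightarrow> 'b::{banach, second_countable_topology}"
  assumes "A \<in> sets M" "f \<in> borel_measurable M"
  shows "integral\<^sup>L (restr M A) f = (LINT x|M. indicator A x *\<^sub>R f x)"
proof -
  have "restr M A = density M (\<lambda>x. ennreal (indicator A x))"
    by (simp add: restr_def ennreal_indicator)
  then show ?thesis using assms by (simp add: integral_density)
qed

lemma integrable_restr:
  fixes f :: "'a \<Rightarrow> 'b::{banach, second_countable_topology}"
  assumes "A \<in> sets M" "integrable M f"
  shows "integrable (restr M A) f"
proof -
  have "restr M A = density M (\<lambda>x. ennreal (indicator A x))"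
    by (simp add: restr_def ennreal_indicator)
  then show ?thesis using assms
    by (auto simp: integrable_density intro!: integrable_mult_indicator)
qed

lemma measurable_double_component:
  "(\<lambda>\<omega>. \<omega> k i) \<in> borel_measurable (PiM (UNIV :: nat set) (\<lambda>_. seq_space))"
  by (rule measurable_compose[where f="\<lambda>\<omega>. \<omega> k" and g="\<lambda>x. x i" and N=seq_space])
     (auto intro!: measurable_component_singleton)

text \<open>The law is that of a Poisson number of independent jumps distributed as the normalised
  \<open>R\<close>, minus a constant drift that accounts for the \<open>clip\<close> term. If
  \<open>R\<close> vanishes there is nothing to normalise, and the point mass at the zero sequence
  serves.\<close>

lemma compound_poisson_law_exists:
  assumes "finite_measure R" and R: "sets R = sets seq_space"
  obtains P where "prob_space P" "sets P = sets seq_space"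
    "\<And>a. finite {i. a i \<noteq> 0} \<Longrightarrow> char_fun P a = exp (CLINT x|R. lk_integrand a x)"
proof -
  interpret R: finite_measure R by fact
  note [measurable_cong] = R
  have sp: "space R = UNIV" using R by (auto dest: sets_eq_imp_space_eq simp: space_PiM)
  define r where "r = measure R (space R)"
  show thesis
  proof (cases "r = 0")
    case True
    then have "emeasure R (space R) = 0" by (simp add: r_def R.emeasure_eq_measure)
    then have "AE x in R. False" by (intro AE_I[of _ _ "space R"]) auto
    then have 0: "(CLINT x|R. lk_integrand a x) = 0" for a
      by (subst integral_cong_AE[where g="\<lambda>_. 0"]) auto
    show ?thesis
    proof (rule that)
      show "prob_space (return seq_space (\<lambda>_. 0))" by (rule prob_space_return) (simp add: space_PiM)
      show "char_fun (return seq_space (\<lambda>_. 0)) a = exp (CLINT x|R. lk_integrand a x)" for a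
        unfolding char_fun_def by (subst integral_return) (auto simp: 0 space_PiM pairing_def)
    qed simp
  next
    case False
    then have r: "r > 0" by (simp add: r_def zero_less_measure_iff)
    define \<rho> where "\<rho> = density R (\<lambda>_. ennreal (1 / r))"
    have \<rho>_sets [measurable_cong]: "sets \<rho> = sets seq_space" using R by (simp add: \<rho>_def)
    have \<rho>: "prob_space \<rho>"
    proof
      have "emeasure \<rho> (space \<rho>) = ennreal (1 / r) * ennreal r"
        by (simp add: \<rho>_def emeasure_density_const R.emeasure_eq_measure r_def)
      also have "\<dots> = 1" using r by (simp flip: ennreal_mult')
      finally show "emeasure \<rho> (space \<rho>) = 1" .
    qed
    define W where "W = PiM (UNIV :: nat set) (\<lambda>_. \<rho>)"
    define N where "N = measure_pmf (poisson_pmf r)"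
    \<comment> \<open>The drift compensating the clipped jumps; the integral exists because
      \<open>clip\<close> is bounded and \<open>R\<close> is finite.\<close>
    define d where "d i = (LINT x|R. clip x i)" for i
    have W_sets [measurable_cong]: "sets W = sets (PiM UNIV (\<lambda>_. seq_space))"
      unfolding W_def by (rule sets_PiM_cong) (simp_all add: \<rho>_sets)
    interpret W: prob_space W unfolding W_def by (rule prob_space_PiM) (rule \<rho>)
    interpret N: prob_space N unfolding N_def by (rule measure_pmf.prob_space_axioms)
    interpret NW: pair_prob_space N W ..
    have N_sets [measurable_cong]: "sets N = sets (count_space UNIV)" by (simp add: N_def)
    \<comment> \<open>The first \<open>n\<close> terms of an infinite sequence of jumps are added,
      so that the space of the jumps does not depend on the Poisson number \<open>n\<close>.\<close>
    define F where "F = (\<lambda>(n::nat, \<xi>) i. (\<Sum>k<n. \<xi> k i) - d i :: real)"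
    have F_meas [measurable]: "F \<in> measurable (N \<Otimes>\<^sub>M W) seq_space"
    proof -
      have "(\<lambda>p. (\<Sum>k<fst p. snd p k i) - d i) \<in> borel_measurable (N \<Otimes>\<^sub>M W)" for i
      proof -
        have coord: "(\<lambda>\<omega>. \<omega> k i) \<in> borel_measurable W" for k
          by (subst measurable_cong_sets[OF W_sets refl], rule measurable_double_component)
        have "(\<lambda>p. (\<Sum>k<n. snd p k i)) \<in> borel_measurable (N \<Otimes>\<^sub>M W)" for n
          by (intro borel_measurable_sum measurable_compose[OF measurable_snd coord])
        then have "(\<lambda>p. (\<Sum>k<fst p. snd p k i)) \<in> borel_measurable (N \<Otimes>\<^sub>M W)"
          by (rule measurable_compose_countable) measurable
        then show ?thesis by measurable
      qed
      then show ?thesis unfolding F_def case_prod_beta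
        by (rule measurable_abs_UNIV)
    qed
    show ?thesis
    proof (rule that)
      show "prob_space (distr (N \<Otimes>\<^sub>M W) seq_space F)" by (rule NW.prob_space_distr) measurable
      fix a :: "int \<Rightarrow> real" assume a: "finite {i. a i \<noteq> 0}"
      define \<phi> where "\<phi> = char_fun \<rho> a"
      interpret \<rho>: prob_space \<rho> by (rule \<rho>)
      have "norm \<phi> \<le> (LINT x|\<rho>. norm (iexp (pairing a x)))"
        unfolding \<phi>_def char_fun_def by (rule integral_norm_bound)
      then have \<phi>1: "norm \<phi> \<le> 1" by (simp add: \<rho>.prob_space)
      have pF: "pairing a (F (n, \<xi>)) = (\<Sum>k<n. pairing a (\<xi> k)) - pairing a d" for n \<xi>
        unfolding pairing_def F_def
        by (simp add: right_diff_distrib sum_subtractf sum_distrib_left sum.swap[of _ "{..<n}"])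
      have "char_fun (distr (N \<Otimes>\<^sub>M W) seq_space F) a = (CLINT p|N \<Otimes>\<^sub>M W. iexp (pairing a (F p)))"
        unfolding char_fun_def by (rule integral_distr) measurable
      also have "\<dots> = (CLINT n|N. CLINT \<xi>|W. iexp (pairing a (F (n, \<xi>))))"
        by (rule NW.integral_fst'[symmetric]) (rule NW.integrable_const_bound[of _ 1], auto)
      also have "\<dots> = (CLINT n|N. \<phi> ^ n * iexp (- pairing a d))"
      proof (rule Bochner_Integration.integral_cong[OF refl])
        fix n
        have "(CLINT \<xi>|W. iexp (pairing a (F (n, \<xi>)))) =
              (CLINT \<xi>|W. iexp (\<Sum>k<n. pairing a (\<xi> k)) * iexp (- pairing a d))"
          unfolding pF by (simp add: right_diff_distrib exp_diff exp_minus divide_inverse)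
        also have "\<dots> = (CLINT \<xi>|W. iexp (\<Sum>k<n. pairing a (\<xi> k))) * iexp (- pairing a d)"
          by (rule integral_mult_left_zero)
        also have "(CLINT \<xi>|W. iexp (\<Sum>k<n. pairing a (\<xi> k))) = \<phi> ^ n"
          unfolding W_def using char_fun_sum_PiM[of "\<lambda>_. \<rho>" a n] \<rho> \<rho>_sets by (simp add: \<phi>_def)
        finally show "(CLINT \<xi>|W. iexp (pairing a (F (n, \<xi>)))) = \<phi> ^ n * iexp (- pairing a d)" .
      qed
      also have "\<dots> = (CLINT n|N. \<phi> ^ n) * iexp (- pairing a d)"
        by (rule integral_mult_left_zero)
      also have "(CLINT n|N. \<phi> ^ n) = exp (of_real r * (\<phi> - 1))"
        unfolding N_def by (rule integral_poisson_pmf_power[OF r \<phi>1])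
      also have "exp (of_real r * (\<phi> - 1)) * iexp (- pairing a d) =
          exp (of_real r * \<phi> - of_real r - \<i> * of_real (pairing a d))"
        by (simp add: exp_add[symmetric] algebra_simps)
      also have "of_real r * \<phi> - of_real r - \<i> * of_real (pairing a d) = (CLINT x|R. lk_integrand a x)"
      proof -
        have clip_int: "integrable R (\<lambda>x. clip x i)" for i
          by (rule R.integrable_const_bound[of _ 1]) (auto simp: clip_def)
        have p_int: "integrable R (\<lambda>x. pairing a (clip x))"
          unfolding pairing_def using clip_int by auto
        have e_int: "integrable R (\<lambda>x. iexp (pairing a x))"
          by (rule R.integrable_const_bound[of _ 1]) auto
        have "of_real r * \<phi> = (CLINT x|R. iexp (pairing a x))"
          unfolding \<phi>_def char_fun_def \<rho>_def using r
          by (subst integral_density) (auto simp: scaleR_conv_of_real)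
        moreover have "pairing a d = (LINT x|R. pairing a (clip x))"
          unfolding pairing_def d_def using clip_int by simp
        moreover have "of_real r = (CLINT x|R. 1)" by (simp add: r_def scaleR_conv_of_real)
        ultimately show ?thesis
          unfolding lk_integrand_def using e_int p_int by simp
      qed
      finally show "char_fun (distr (N \<Otimes>\<^sub>M W) seq_space F) a = exp (CLINT x|R. lk_integrand a x)" .
    qed simp
  qed
qed

section \<open>Tails of the coordinates of an IDp law\<close>

lemma norm_exp_minus_one_le:
  fixes z :: complex
  assumes "norm z \<le> 1"
  shows "norm (exp z - 1) \<le> 3 * norm z"
proof -
  have "norm (exp z - exp 0) \<le> 3 * norm (z - 0)"
  proof (rule field_differentiable_bound[where S="cball 0 1" and f'=exp])
    fix w :: complex assume "w \<in> cball 0 1"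
    then have "exp (norm w) \<le> exp 1" by simp
    with norm_exp[of w] exp_le show "norm (exp w) \<le> 3" by linarith
  qed (use assms in \<open>auto intro!: derivative_eq_intros\<close>)
  then show ?thesis by simp
qed

text \<open>The characteristic function of one coordinate differs from \<open>1\<close> by at most
  three times the modulus of its exponent, which is controlled by the truncated second moment of
  \<open>R\<close>; \<open>tail_le_char\<close> then bounds the tail. Since the bound is linear in
  that moment, a piece of the Levy measure with small moment contributes small coordinates.\<close>

lemma idp_char_tail:
  assumes "prob_space P" and P: "sets P = sets seq_space" and R: "sets R = sets seq_space"
    and cf: "\<And>a. finite {i. a i \<noteq> 0} \<Longrightarrow> char_fun P a = exp (CLINT x|R. lk_integrand a x)"
    and int: "integrable R (\<lambda>x. min ((x i)\<^sup>2) 1)" and \<delta>: "\<delta> > 0"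
  shows "measure P {x. \<delta> \<le> \<bar>x i\<bar>} \<le> (6 + 16 / \<delta>\<^sup>2) * (3 * (LINT x|R. min ((x i)\<^sup>2) 1))"
proof -
  interpret prob_space P by fact
  note [measurable_cong] = P R
  define m where "m = (LINT x|R. min ((x i)\<^sup>2) 1)"
  have sp: "space P = UNIV" using P by (auto dest: sets_eq_imp_space_eq simp: space_PiM)
  interpret X: real_distribution "distr P borel (\<lambda>x. x i)"
    by (rule real_distribution_distr) measurable
  have "measure (distr P borel (\<lambda>x. x i)) {y. \<delta> \<le> \<bar>y\<bar>} \<le> (6 + 16 / \<delta>\<^sup>2) * (3 * m)"
  proof (rule X.tail_le_char[OF _ \<delta>])
    fix t
    let ?c = "char (distr P borel (\<lambda>x. x i)) t"
    let ?a = "\<lambda>j. if j = i then t else 0"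
    define z where "z = (CLINT x|R. lk_integrand ?a x)"
    have "?c = char_fun P ?a"
      unfolding char_def char_fun_def by (subst integral_distr) simp_all
    also have "\<dots> = exp z" unfolding z_def by (rule cf) simp
    finally have c: "?c = exp z" .
    have lk_integrand: "norm (lk_integrand ?a x) \<le> (3 + 2 * t\<^sup>2) * min ((x i)\<^sup>2) 1" for x
      by (rule norm_lk_single_le)
    have "norm z \<le> (LINT x|R. norm (lk_integrand ?a x))"
      unfolding z_def by (rule integral_norm_bound)
    also have "\<dots> \<le> (LINT x|R. (3 + 2 * t\<^sup>2) * min ((x i)\<^sup>2) 1)"
    proof (rule integral_mono)
      show "integrable R (\<lambda>x. norm (lk_integrand ?a x))"
        by (rule Bochner_Integration.integrable_bound[OF integrable_mult_right[OF int, of "3 + 2 * t\<^sup>2"]])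
           (use lk_integrand in \<open>auto simp: abs_mult\<close>)
    qed (use int lk_integrand in auto)
    also have "\<dots> = (3 + 2 * t\<^sup>2) * m" by (simp add: m_def)
    finally have z: "norm z \<le> (3 + 2 * t\<^sup>2) * m" .
    have "norm (1 - ?c) \<le> 3 * norm z"
    proof (cases "norm z \<le> 1")
      case True
      then show ?thesis unfolding c using norm_exp_minus_one_le[OF True] by (simp add: norm_minus_commute)
    next
      case False
      \<comment> \<open>A difference of two numbers in the unit disc is at most \<open>2\<close>,
        and here \<open>2 \<le> 3 * norm z\<close>.\<close>
      have "norm (1 - ?c) \<le> norm (1::complex) + norm ?c" by (rule norm_triangle_ineq4)
      then show ?thesis using False X.cmod_char_le_1[of t] unfolding norm_one by linarith
    qed
    also have "\<dots> \<le> (3 + 2 * t\<^sup>2) * (3 * m)" using z by argo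
    finally show "norm (1 - ?c) \<le> (3 + 2 * t\<^sup>2) * (3 * m)" .
  qed
  moreover have "measure (distr P borel (\<lambda>x. x i)) {y. \<delta> \<le> \<bar>y\<bar>} = measure P {x. \<delta> \<le> \<bar>x i\<bar>}"
    by (subst measure_distr) (auto simp: sp vimage_def)
  ultimately show ?thesis by (simp add: m_def)
qed

lemma integrable_min_square:
  assumes "sets Q = sets seq_space" "(\<integral>\<^sup>+ x. ennreal (min ((x i)\<^sup>2) 1) \<partial>Q) < \<infinity>"
  shows "integrable Q (\<lambda>x. min ((x i)\<^sup>2) 1)"
proof -
  note [measurable_cong] = assms(1)
  show ?thesis using assms(2) by (intro integrableI_nonneg) auto
qed

lemma integrable_lk:
  assumes Q: "sets Q = sets seq_space"
    and fin: "\<And>i. (\<integral>\<^sup>+ x. ennreal (min ((x i)\<^sup>2) 1) \<partial>Q) < \<infinity>"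
    and a: "finite {i. a i \<noteq> 0}"
  shows "integrable Q (lk_integrand a)"
proof -
  note [measurable_cong] = Q
  define K where "K = 2 + (\<Sum>i\<in>{i. a i \<noteq> 0}. \<bar>a i\<bar>) + (\<Sum>i\<in>{i. a i \<noteq> 0}. \<bar>a i\<bar>)\<^sup>2"
  have "K \<ge> 0" unfolding K_def by (intro add_nonneg_nonneg sum_nonneg) auto
  moreover have "0 \<le> (\<Sum>i\<in>{i. a i \<noteq> 0}. min ((x i)\<^sup>2) 1)" for x :: "int \<Rightarrow> real"
    by (rule sum_nonneg) simp
  moreover have "integrable Q (\<lambda>x. K * (\<Sum>i\<in>{i. a i \<noteq> 0}. min ((x i)\<^sup>2) 1))"
    using integrable_min_square[OF Q fin] by auto
  ultimately show ?thesis
    using norm_lk_le[OF a] by (elim Bochner_Integration.integrable_bound) (auto simp: K_def abs_mult)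
qed

text \<open>
  The Levy measure is cut into countably many finite pieces whose compound Poisson
  laws have coordinates of summable size, so that independent variables with these laws can be
  added up coordinatewise.
\<close>

lemma idp_law_exists:
  assumes Q: "sets Q = sets seq_space" "sigma_finite_measure Q"
    and fin: "\<And>i. (\<integral>\<^sup>+ x. ennreal (min ((x i)\<^sup>2) 1) \<partial>Q) < \<infinity>"
  obtains P where "prob_space P" "sets P = sets seq_space"
    "\<And>a. finite {i. a i \<noteq> 0} \<Longrightarrow> char_fun P a = exp (CLINT x|Q. lk_integrand a x)"
proof -
  interpret sigma_finite_measure Q by fact
  note [measurable_cong] = Q(1)
  have sp: "space Q = UNIV" using Q(1) by (auto dest: sets_eq_imp_space_eq simp: space_PiM)
  have univ: "UNIV \<in> sets Q" using sets.top[of Q] sp by simp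
  note min_int = integrable_min_square[OF Q(1) fin]
  obtain E where E: "range E \<subseteq> sets Q" "(\<Union>i. E i) = UNIV" "\<And>i. emeasure Q (E i) \<noteq> \<infinity>" "incseq E"
    using sigma_finite_incseq sp by metis
  have E_meas[measurable]: "E n \<in> sets Q" for n using E(1) by auto
  \<comment> \<open>The weight turns \<open>Q\<close> into a finite measure, so that continuity from
    above makes the mass outside \<open>E n\<close> tend to \<open>0\<close> even if
    \<open>Q\<close> is infinite.\<close>
  define G where "G i = density Q (\<lambda>x. ennreal (min ((x i)\<^sup>2) 1))" for i
  have G_sets[measurable_cong]: "sets (G i) = sets seq_space" for i using Q(1) by (simp add: G_def)
  have G_fin: "finite_measure (G i)" for i
    by (rule finite_measureI) (use fin[of i] in \<open>auto simp: G_def emeasure_density cong: nn_integral_cong\<close>)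
  have G_lim: "(\<lambda>n. measure (G i) (UNIV - E n)) \<longlonglongrightarrow> 0" for i
  proof -
    interpret G: finite_measure "G i" by (rule G_fin)
    have "(\<lambda>n. measure (G i) (UNIV - E n)) \<longlonglongrightarrow> measure (G i) (\<Inter>n. UNIV - E n)"
      using E(4) by (intro G.finite_Lim_measure_decseq) (auto simp: decseq_def incseq_def G_def sp[symmetric])
    moreover have "(\<Inter>n. UNIV - E n) = {}" using E(2) by auto
    ultimately show ?thesis by (simp only: measure_empty)
  qed
  \<comment> \<open>Stage \<open>k\<close> controls only the coordinates between \<open>- k\<close>
    and \<open>k\<close>, so each coordinate is controlled from some stage on. The rate
    \<open>1/16\<close> has to beat the factor of order \<open>4 ^ k\<close> that
    \<open>idp_char_tail\<close> produces at the threshold \<open>(1/2) ^ Suc k\<close>, and to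
    leave a summable remainder.\<close>
  have "\<exists>r\<ge>k. \<forall>i\<in>{- int k..int k}. measure (G i) (UNIV - E r) < (1/16) ^ k" for k
  proof -
    have "\<forall>\<^sub>F r in sequentially. \<forall>i\<in>{- int k..int k}. measure (G i) (UNIV - E r) < (1/16) ^ k"
      by (intro eventually_ball_finite ballI order_tendstoD[OF G_lim]) auto
    with eventually_ge_at_top[of k]
    have "\<forall>\<^sub>F r in sequentially. r \<ge> k \<and> (\<forall>i\<in>{- int k..int k}. measure (G i) (UNIV - E r) < (1/16) ^ k)"
      by (rule eventually_conj)
    then show ?thesis by (rule eventually_happens'[OF sequentially_bot])
  qed
  then obtain r where r: "\<And>k. r k \<ge> k"
    "\<And>k i. i \<in> {- int k..int k} \<Longrightarrow> measure (G i) (UNIV - E (r k)) < (1/16) ^ k"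
    by metis
  \<comment> \<open>The unions make the sets increasing although \<open>r\<close> need not be
    monotone; \<open>r k \<ge> k\<close> makes them exhaust the space.\<close>
  define F where "F k = (\<Union>j\<le>k. E (r j))" for k
  define A where "A = disjointed F"
  have F_meas[measurable]: "F k \<in> sets Q" for k unfolding F_def by measurable
  have A_meas[measurable]: "A k \<in> sets Q" for k
  proof -
    have "range F \<subseteq> sets Q" using F_meas by blast
    from sets.range_disjointed_sets[OF this] show ?thesis unfolding A_def by blast
  qed
  have A_disj: "disjoint_family A" unfolding A_def by (rule disjoint_family_disjointed)
  have "(\<Union>k. F k) = UNIV"
  proof -
    have "E k \<subseteq> F k" for k
      using incseqD[OF E(4) r(1)[of k]] unfolding F_def by blast
    then have "(\<Union>k. E k) \<subseteq> (\<Union>k. F k)" by (intro UN_mono) auto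
    then show ?thesis unfolding E(2) by (simp only: top.extremum_unique)
  qed
  then have A_UN: "(\<Union>k. A k) = UNIV" unfolding A_def UN_disjointed_eq .
  have A_fin: "emeasure Q (A k) < \<infinity>" for k
  proof -
    have "emeasure Q (A k) \<le> emeasure Q (F k)"
      using disjointed_subset[of F k] by (intro emeasure_mono) (auto simp: A_def)
    also have "\<dots> \<le> (\<Sum>j\<le>k. emeasure Q (E (r j)))"
      unfolding F_def by (rule emeasure_subadditive_finite) auto
    also have "\<dots> < \<infinity>" using E(3) by (simp add: less_top)
    finally show ?thesis .
  qed
  \<comment> \<open>The index is shifted because it is \<open>A (Suc k)\<close> that misses
    \<open>E (r k)\<close>. The piece \<open>A 0\<close> has no such bound, only finite mass, and
    convergence of the series ignores it.\<close>
  have A_small: "(LINT x|restr Q (A (Suc k)). min ((x i)\<^sup>2) 1) \<le> (1/16) ^ k" if "\<bar>i\<bar> \<le> int k" for i k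
  proof -
    interpret G: finite_measure "G i" by (rule G_fin)
    have "(LINT x|restr Q (A (Suc k)). min ((x i)\<^sup>2) 1) = (LINT x|Q. min ((x i)\<^sup>2) 1 * indicator (A (Suc k)) x)"
      by (subst integral_restr) (auto simp: mult.commute)
    also have "\<dots> = (LINT x|G i. indicator (A (Suc k)) x)"
      unfolding G_def by (subst integral_density) auto
    also have "\<dots> = measure (G i) (A (Suc k))" by (simp add: G_def sp)
    also have "\<dots> \<le> measure (G i) (UNIV - E (r k))"
    proof (rule G.finite_measure_mono)
      show "A (Suc k) \<subseteq> UNIV - E (r k)"
        by (auto simp: A_def disjointed_def F_def)
      show "UNIV - E (r k) \<in> sets (G i)" by (simp add: G_def sp[symmetric])
    qed
    also have "\<dots> \<le> (1/16) ^ k" using r(2)[of i k] that by (simp add: abs_le_iff)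
    finally show ?thesis .
  qed
  have "\<exists>P. prob_space P \<and> sets P = sets seq_space \<and>
      (\<forall>a. finite {i. a i \<noteq> 0} \<longrightarrow> char_fun P a = exp (CLINT x|restr Q (A k). lk_integrand a x))" for k
  proof -
    have "finite_measure (restr Q (A k))"
      using A_fin[of k] by (intro finite_measureI) (simp add: emeasure_restr sp less_top univ)
    then show ?thesis
      by (rule compound_poisson_law_exists[where R="restr Q (A k)"]) (auto simp: Q(1))
  qed
  then obtain P where P: "\<And>k. prob_space (P k)" and P_sets: "\<And>k. sets (P k) = sets seq_space"
    and P_cf: "\<And>k a. finite {i. a i \<noteq> 0} \<Longrightarrow> char_fun (P k) a = exp (CLINT x|restr Q (A k). lk_integrand a x)"
    by metis
  define W where "W = PiM (UNIV :: nat set) P"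
  have W_sets [measurable_cong]: "sets W = sets (PiM UNIV (\<lambda>_. seq_space))"
    unfolding W_def by (rule sets_PiM_cong) (simp_all add: P_sets)
  interpret PP: product_prob_space P UNIV by (rule product_prob_spaceI) (rule P)
  interpret W: prob_space W unfolding W_def by (rule prob_space_PiM) (rule P)
  have spW: "space W = UNIV"
    unfolding sets_eq_imp_space_eq[OF W_sets] by (simp add: space_PiM)
  have coord[measurable]: "(\<lambda>\<omega>. \<omega> k i) \<in> borel_measurable W" for k i
    by (subst measurable_cong_sets[OF W_sets refl], rule measurable_double_component)
  have tail: "measure W {\<omega>. (1/2) ^ Suc k \<le> \<bar>\<omega> (Suc k) i\<bar>} \<le> 210 * (1/4) ^ k" if "\<bar>i\<bar> \<le> int k" for i k
  proof -
    have "measure W {\<omega>. (1/2) ^ Suc k \<le> \<bar>\<omega> (Suc k) i\<bar>} = measure (P (Suc k)) {x. (1/2) ^ Suc k \<le> \<bar>x i\<bar>}"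
    proof -
      have "(\<lambda>x. x i) \<in> borel_measurable (P (Suc k))"
        by (subst measurable_cong_sets[OF P_sets refl]) simp
      then have "{x \<in> space (P (Suc k)). (1/2) ^ Suc k \<le> \<bar>x i\<bar>} \<in> sets (P (Suc k))" by measurable
      moreover have "space (P (Suc k)) = UNIV"
        using P_sets[of "Suc k"] by (auto dest: sets_eq_imp_space_eq simp: space_PiM)
      ultimately have "measure (distr W (P (Suc k)) (\<lambda>\<omega>. \<omega> (Suc k))) {x. (1/2) ^ Suc k \<le> \<bar>x i\<bar>}
          = measure W {\<omega>. (1/2) ^ Suc k \<le> \<bar>\<omega> (Suc k) i\<bar>}"
        unfolding W_def by (subst measure_distr) (auto simp: vimage_def spW[unfolded W_def])
      then show ?thesis by (simp add: W_def PP.PiM_component)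
    qed
    also have "\<dots> \<le> (6 + 16 / ((1/2) ^ Suc k)\<^sup>2) * (3 * (LINT x|restr Q (A (Suc k)). min ((x i)\<^sup>2) 1))"
      by (rule idp_char_tail[OF P P_sets _ P_cf integrable_restr[OF A_meas min_int]]) (auto simp: Q(1))
    also have "\<dots> \<le> (70 * 4 ^ k) * (3 * (1/16) ^ k)"
    proof (rule mult_mono)
      have "((1/2::real) ^ Suc k)\<^sup>2 = (1/4) ^ Suc k"
        unfolding power2_eq_square power_mult_distrib[symmetric] by simp
      then have "(16::real) / ((1/2) ^ Suc k)\<^sup>2 = 64 * 4 ^ k"
        by (simp add: power_divide)
      moreover have "(1::real) \<le> 4 ^ k" by simp
      ultimately show "6 + 16 / ((1/2::real) ^ Suc k)\<^sup>2 \<le> 70 * 4 ^ k" by linarith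
    qed (use A_small[OF that] in \<open>auto intro!: Bochner_Integration.integral_nonneg\<close>)
    also have "\<dots> = 210 * (4 * (1/16)) ^ k"
      unfolding power_mult_distrib by simp
    also have "\<dots> = 210 * (1/4) ^ k" by simp
    finally show ?thesis .
  qed
  have summ: "AE \<omega> in W. summable (\<lambda>k. \<omega> k i)" for i
  proof -
    have "AE \<omega> in W. \<forall>\<^sub>F k in sequentially. \<omega> \<in> space W - {\<omega> \<in> space W. (1/2) ^ Suc k \<le> \<bar>\<omega> (Suc k) i\<bar>}"
    proof (rule borel_cantelli_AE1)
      show "summable (\<lambda>k. measure W {\<omega> \<in> space W. (1/2) ^ Suc k \<le> \<bar>\<omega> (Suc k) i\<bar>})"
      proof (rule summable_comparison_test_ev)
        show "\<forall>\<^sub>F k in sequentially. norm (measure W {\<omega> \<in> space W. (1/2) ^ Suc k \<le> \<bar>\<omega> (Suc k) i\<bar>}) \<le> 210 * (1/4) ^ k"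
          using eventually_ge_at_top[of "nat \<bar>i\<bar>"]
        proof eventually_elim
          case (elim k)
          then show ?case using tail[of i k] by (simp add: spW)
        qed
      qed (auto intro!: summable_mult summable_geometric)
    qed (auto simp: W.emeasure_eq_measure)
    then show ?thesis
    proof eventually_elim
      case (elim \<omega>)
      then have "\<forall>\<^sub>F k in sequentially. norm (\<omega> (Suc k) i) \<le> (1/2) ^ Suc k"
        by eventually_elim (auto simp: spW)
      then have "summable (\<lambda>k. \<omega> (Suc k) i)"
        by (rule summable_comparison_test_ev) (auto intro!: summable_mult summable_geometric)
      then show ?case by (rule summable_Suc_iff[where f="\<lambda>k. \<omega> k i", THEN iffD1])
    qed
  qed
  \<comment> \<open>Where a series diverges its value is unspecified; \<open>summ\<close> confines
    this to a null set, since there are countably many coordinates.\<close>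
  define S where "S \<omega> i = (\<Sum>k. \<omega> k i)" for \<omega> :: "nat \<Rightarrow> int \<Rightarrow> real" and i
  have S_meas[measurable]: "S \<in> measurable W seq_space"
    unfolding S_def[abs_def] by (rule measurable_abs_UNIV) measurable
  show thesis
  proof (rule that)
    show "prob_space (distr W seq_space S)" by (rule W.prob_space_distr) measurable
    fix a :: "int \<Rightarrow> real" assume a: "finite {i. a i \<noteq> 0}"
    have pm[measurable]: "(\<lambda>\<omega>. pairing a (\<omega> k)) \<in> borel_measurable W" for k
      unfolding pairing_def by measurable
    have "(\<lambda>n. CLINT \<omega>|W. iexp (\<Sum>k<n. pairing a (\<omega> k))) \<longlonglongrightarrow> (CLINT \<omega>|W. iexp (pairing a (S \<omega>)))"
    proof (rule integral_dominated_convergence[where w="\<lambda>_. 1"])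
      have "AE \<omega> in W. \<forall>i. summable (\<lambda>k. \<omega> k i)" using summ by (simp add: AE_all_countable)
      then show "AE \<omega> in W. (\<lambda>n. iexp (\<Sum>k<n. pairing a (\<omega> k))) \<longlonglongrightarrow> iexp (pairing a (S \<omega>))"
      proof eventually_elim
        case (elim \<omega>)
        have "(\<lambda>k. pairing a (\<omega> k)) sums pairing a (S \<omega>)"
          unfolding pairing_def S_def using elim by (intro sums_sum sums_mult summable_sums) auto
        then show ?case unfolding sums_def by (intro tendsto_intros)
      qed
    qed auto
    moreover have "(CLINT \<omega>|W. iexp (\<Sum>k<n. pairing a (\<omega> k))) = exp (\<Sum>k<n. CLINT x|restr Q (A k). lk_integrand a x)" for n
      unfolding W_def char_fun_sum_PiM[OF P P_sets] using P_cf[OF a] by (simp add: exp_sum)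
    \<comment> \<open>The pieces are disjoint and cover the space, so at each point the partial sums
      are \<open>0\<close> up to one index and the full integrand after it; the norm of the
      integrand dominates them.\<close>
    moreover have "(\<lambda>n. \<Sum>k<n. CLINT x|restr Q (A k). lk_integrand a x) \<longlonglongrightarrow> (CLINT x|Q. lk_integrand a x)"
    proof -
      note lk_int = integrable_lk[OF Q(1) fin a]
      have "(\<Sum>k<n. CLINT x|restr Q (A k). lk_integrand a x) = (CLINT x|Q. \<Sum>k<n. indicator (A k) x *\<^sub>R lk_integrand a x)" for n
        using lk_int by (subst Bochner_Integration.integral_sum)
          (auto simp: integral_restr intro!: integrable_mult_indicator sum.cong)
      moreover have "(\<lambda>n. CLINT x|Q. \<Sum>k<n. indicator (A k) x *\<^sub>R lk_integrand a x) \<longlonglongrightarrow> (CLINT x|Q. lk_integrand a x)"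
      proof (rule integral_dominated_convergence[where w="\<lambda>x. norm (lk_integrand a x)"])
        have *: "\<exists>K. \<forall>k. indicator (A k) x *\<^sub>R lk_integrand a x = (if k = K then lk_integrand a x else 0)" for x
        proof -
          obtain K where K: "x \<in> A K" using A_UN by blast
          have "x \<in> A k \<longleftrightarrow> k = K" for k
            using K A_disj unfolding disjoint_family_on_def by blast
          then show ?thesis by (intro exI[of _ K]) (auto simp: indicator_def)
        qed
        show "AE x in Q. (\<lambda>n. \<Sum>k<n. indicator (A k) x *\<^sub>R lk_integrand a x) \<longlonglongrightarrow> lk_integrand a x"
        proof (rule AE_I2)
          fix x
          obtain K where "\<And>k. indicator (A k) x *\<^sub>R lk_integrand a x = (if k = K then lk_integrand a x else 0)"
            using * by blast
          then show "(\<lambda>n. \<Sum>k<n. indicator (A k) x *\<^sub>R lk_integrand a x) \<longlonglongrightarrow> lk_integrand a x"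
            using sums_single[of K "\<lambda>_. lk_integrand a x"] by (simp add: sums_def)
        qed
        show "AE x in Q. norm (\<Sum>k<n. indicator (A k) x *\<^sub>R lk_integrand a x) \<le> norm (lk_integrand a x)" for n
        proof (rule AE_I2)
          fix x
          obtain K where "\<And>k. indicator (A k) x *\<^sub>R lk_integrand a x = (if k = K then lk_integrand a x else 0)"
            using * by blast
          then show "norm (\<Sum>k<n. indicator (A k) x *\<^sub>R lk_integrand a x) \<le> norm (lk_integrand a x)"
            by (simp add: sum.delta)
        qed
      qed (use lk_int in auto)
      ultimately show ?thesis by simp
    qed
    ultimately have "(\<lambda>n. exp (\<Sum>k<n. CLINT x|restr Q (A k). lk_integrand a x)) \<longlonglongrightarrow> (CLINT \<omega>|W. iexp (pairing a (S \<omega>)))"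
      and "(\<lambda>n. exp (\<Sum>k<n. CLINT x|restr Q (A k). lk_integrand a x)) \<longlonglongrightarrow> exp (CLINT x|Q. lk_integrand a x)"
      by (auto intro: tendsto_exp)
    then have "(CLINT \<omega>|W. iexp (pairing a (S \<omega>))) = exp (CLINT x|Q. lk_integrand a x)"
      by (rule LIMSEQ_unique)
    then show "char_fun (distr W seq_space S) a = exp (CLINT x|Q. lk_integrand a x)"
      unfolding char_fun_def by (subst integral_distr) auto
  qed simp
qed

section \<open>The canonical parts\<close>

lemma measurable_shift [measurable]: "shift n \<in> measurable seq_space seq_space"
  unfolding shift_def[abs_def] by (rule measurable_abs_UNIV) measurable

lemma measurable_scale_seq [measurable]: "scale_seq b \<in> measurable seq_space seq_space"
  unfolding scale_seq_def[abs_def] by (rule measurable_abs_UNIV) measurable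

lemma shift_shift: "shift m (shift n x) = shift (m + n) x"
  by (simp add: shift_def fun_eq_iff ac_simps)

lemma shift_0 [simp]: "shift 0 x = x"
  by (simp add: shift_def)

lemma shift_scale_seq: "scale_seq b (shift n x) = shift n (scale_seq b x)"
  by (simp add: shift_def scale_seq_def)

lemma space_eq_UNIV_if_sets_seq:
  assumes "sets M = sets seq_space"
  shows "space M = UNIV"
  using sets_eq_imp_space_eq[OF assms] by (simp add: space_PiM)

lemma vimage_sets_seq:
  assumes "sets M = sets seq_space" "f \<in> measurable seq_space seq_space" "A \<in> sets M"
  shows "f -` A \<in> sets M"
  using measurable_sets[OF assms(2), of A] assms by (simp add: space_PiM)

lemma emeasure_shift_vimage:
  assumes M: "sets M = sets seq_space" "shift_invariant M" and A: "A \<in> sets M"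
  shows "emeasure M (shift (int n) -` A) = emeasure M A"
proof (induction n)
  case 0
  then show ?case by (simp add: vimage_def)
next
  case (Suc n)
  note [measurable_cong] = M(1)
  have "shift (int (Suc n)) -` A = shift 1 -` (shift (int n) -` A)"
    by (simp add: vimage_def shift_shift ac_simps)
  moreover have "shift (int n) -` A \<in> sets M"
    by (rule vimage_sets_seq[OF M(1) measurable_shift A])
  moreover have "emeasure (distr M seq_space (shift 1)) B = emeasure M (shift 1 -` B)" if "B \<in> sets M" for B
    using that M(1) by (subst emeasure_distr) (simp_all add: space_eq_UNIV_if_sets_seq)
  ultimately show ?case using Suc M(2) by (simp add: shift_invariant_def)
qed

text \<open>
  If \<open>\<nu> (A \<inter> T\<^sup>-\<^sup>k A)\<close> tended to \<open>0\<close>, the number of visits to \<open>A\<close> at \<open>m\<close> sufficiently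
  spaced times would have second moment of order \<open>m\<close> only, less than the square of its mean.
\<close>

lemma invariant_prob_recurrence:
  assumes \<nu>: "invariant_prob \<nu>" and A: "A \<in> sets \<nu>" "measure \<nu> A > 0"
  shows "\<not> (\<lambda>k::nat. measure \<nu> (A \<inter> shift (int k) -` A)) \<longlonglongrightarrow> 0"
proof
  assume lim: "(\<lambda>k::nat. measure \<nu> (A \<inter> shift (int k) -` A)) \<longlonglongrightarrow> 0"
  interpret prob_space \<nu> using \<nu> by (simp add: invariant_prob_def)
  have sets: "sets \<nu> = sets seq_space" and inv: "shift_invariant \<nu>"
    using \<nu> by (auto simp: invariant_prob_def)
  note [measurable_cong] = sets
  define p where "p = measure \<nu> A"
  have p: "p > 0" using A by (simp add: p_def)
  have "\<forall>\<^sub>F k in sequentially. measure \<nu> (A \<inter> shift (int k) -` A) < p\<^sup>2 / 2"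
    using p by (intro order_tendstoD[OF lim]) simp
  then obtain K where K: "\<And>k. k \<ge> K \<Longrightarrow> measure \<nu> (A \<inter> shift (int k) -` A) < p\<^sup>2 / 2"
    by (auto simp: eventually_sequentially)
  \<comment> \<open>Distinct multiples of \<open>L\<close> are more than \<open>K\<close> apart,
    where the bound \<open>p^2 / 2\<close> is in force.\<close>
  define L where "L = Suc K"
  \<comment> \<open>Nonnegativity of the variance will give
    \<open>(m * p)^2 \<le> m * p + (m * p)^2 / 2\<close>, that is
    \<open>m * p \<le> 2\<close>.\<close>
  obtain m :: nat where m: "real m > 2 / p" using reals_Archimedean2 by blast
  then have m0: "m > 0" using p by (cases m) (auto simp: field_simps)
  define C where "C i = shift (int (i * L)) -` A" for i
  have C[measurable]: "C i \<in> sets \<nu>" for i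
    unfolding C_def by (rule vimage_sets_seq[OF sets measurable_shift A(1)])
  have C_measure: "measure \<nu> (C i) = p" for i
    unfolding C_def p_def measure_def by (simp only: emeasure_shift_vimage[OF sets inv A(1)])
  have C_less: "measure \<nu> (C i \<inter> C j) \<le> p\<^sup>2 / 2" if "i < j" for i j
  proof -
    have "C i \<inter> C j = shift (int (i * L)) -` (A \<inter> shift (int ((j - i) * L)) -` A)"
    proof -
      have "int (j * L) = int ((j - i) * L) + int (i * L)"
        using that by (simp flip: of_nat_add distrib_right)
      then show ?thesis by (auto simp: C_def shift_shift)
    qed
    moreover have "A \<inter> shift (int ((j - i) * L)) -` A \<in> sets \<nu>"
      using A(1) vimage_sets_seq[OF sets measurable_shift A(1)] by auto
    ultimately have eq: "measure \<nu> (C i \<inter> C j) = measure \<nu> (A \<inter> shift (int ((j - i) * L)) -` A)"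
      by (simp only: measure_def emeasure_shift_vimage[OF sets inv])
    have "(j - i) * L \<ge> 1 * L" using that by (intro mult_right_mono) auto
    then have "(j - i) * L \<ge> K" by (simp add: L_def)
    from less_imp_le[OF K[OF this]] show ?thesis unfolding eq .
  qed
  have C_le: "measure \<nu> (C i \<inter> C j) \<le> (if i = j then p else 0) + p\<^sup>2 / 2" for i j
    using C_less[of i j] C_less[of j i] C_measure[of i]
    by (cases i j rule: linorder_cases) (auto simp: Int_commute)
  define f where "f x = (\<Sum>i<m. indicator (C i) x :: real)" for x
  have f_mean: "(LINT x|\<nu>. f x) = m * p"
    unfolding f_def by (subst Bochner_Integration.integral_sum) (auto simp: C_measure less_top[symmetric])
  have sq: "(f x)\<^sup>2 = (\<Sum>i<m. \<Sum>j<m. indicator (C i \<inter> C j) x)" for x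
    by (simp add: f_def power2_eq_square sum_product indicator_inter_arith)
  have "(LINT x|\<nu>. (f x)\<^sup>2) = (\<Sum>i<m. \<Sum>j<m. measure \<nu> (C i \<inter> C j))"
    unfolding sq by (simp add: Bochner_Integration.integral_sum less_top[symmetric] del: indicator_inter_arith)
  also have "\<dots> \<le> (\<Sum>i<m. \<Sum>j<m. (if i = j then p else 0) + p\<^sup>2 / 2)"
    by (intro sum_mono C_le)
  also have "\<dots> = m * p + m\<^sup>2 * (p\<^sup>2 / 2)"
    by (simp add: sum.distrib power2_eq_square algebra_simps)
  finally have second: "(LINT x|\<nu>. (f x)\<^sup>2) \<le> m * p + m\<^sup>2 * (p\<^sup>2 / 2)" .
  have f_int: "integrable \<nu> f" "integrable \<nu> (\<lambda>x. (f x)\<^sup>2)"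
    unfolding sq by (auto simp: f_def[abs_def] less_top[symmetric] intro!: Bochner_Integration.integrable_sum)
  have "0 \<le> (LINT x|\<nu>. (f x - m * p)\<^sup>2)" by simp
  also have "\<dots> = (LINT x|\<nu>. (f x)\<^sup>2) - (m * p)\<^sup>2"
    using variance_eq[OF f_int] by (simp add: f_mean)
  finally have "(m * p)\<^sup>2 \<le> m * p + m\<^sup>2 * (p\<^sup>2 / 2)" using second by linarith
  then have "(m * p) * (m * p) \<le> (m * p) * 2"
    by (simp add: power2_eq_square algebra_simps)
  then have "m * p \<le> 2" using p m0 by (subst (asm) mult_le_cancel_left_pos) auto
  then show False using m p by (simp add: field_simps)
qed

text \<open>The epsilon-delta form of absolute continuity, valid for infinite \<open>M\<close>
  because only \<open>\<nu>\<close> has to be finite. Along sets of \<open>\<nu>\<close>-measure at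
  least \<open>e\<close> whose \<open>M\<close>-measures are below a geometric sequence,
  Borel-Cantelli makes the upper limit \<open>M\<close>-null and hence \<open>\<nu>\<close>-null,
  while continuity from above gives it \<open>\<nu>\<close>-measure at least
  \<open>e\<close>.\<close>

lemma absolutely_continuous_tendsto_0:
  assumes "finite_measure \<nu>" and sets: "sets \<nu> = sets M" and ac: "absolutely_continuous M \<nu>"
    and B: "\<And>k::nat. B k \<in> sets M" and lim: "(\<lambda>k. emeasure M (B k)) \<longlonglongrightarrow> 0"
  shows "(\<lambda>k. measure \<nu> (B k)) \<longlonglongrightarrow> 0"
proof (rule ccontr)
  interpret finite_measure \<nu> by fact
  note [measurable] = B
  assume "\<not> ?thesis"
  then obtain e where e: "e > 0" and "\<not> (\<forall>\<^sub>F k in sequentially. dist (measure \<nu> (B k)) 0 < e)"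
    unfolding tendsto_iff by blast
  then have freq: "\<exists>\<^sub>F k in sequentially. measure \<nu> (B k) \<ge> e"
    by (simp add: not_eventually not_less)
  have "\<exists>k. measure \<nu> (B k) \<ge> e \<and> emeasure M (B k) < ennreal ((1/2) ^ j)" for j :: nat
  proof -
    have "\<forall>\<^sub>F k in sequentially. emeasure M (B k) < ennreal ((1/2) ^ j)"
      by (rule order_tendstoD[OF lim]) simp
    from frequently_eventually_frequently[OF freq this] show ?thesis
      by (rule frequently_ex)
  qed
  then obtain s where s: "\<And>j. measure \<nu> (B (s j)) \<ge> e"
      "\<And>j. emeasure M (B (s j)) < ennreal ((1/2) ^ j)" by metis
  have lt: "measure M (B (s j)) \<le> (1/2) ^ j" for j
    unfolding measure_def using enn2real_mono[OF less_imp_le[OF s(2)[of j]]] by simp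
  define U where "U n = (\<Union>j\<in>{n..}. B (s j))" for n
  have U[measurable]: "U n \<in> sets \<nu>" for n unfolding U_def sets by measurable
  have "limsup (\<lambda>j. B (s j)) \<in> null_sets M"
  proof (rule borel_cantelli_limsup1)
    show "emeasure M (B (s j)) < \<infinity>" for j using s(2)[of j] by (rule less_trans) simp
    show "summable (\<lambda>j. measure M (B (s j)))"
      by (rule summable_comparison_test'[of "\<lambda>j. (1/2) ^ j" 0]) (use lt in auto)
  qed simp
  then have "limsup (\<lambda>j. B (s j)) \<in> null_sets \<nu>"
    using ac by (auto simp: absolutely_continuous_def)
  then have 0: "measure \<nu> (\<Inter>n. U n) = 0"
    by (simp add: U_def limsup_INF_SUP measure_eq_0_null_sets)
  have "(\<lambda>n. measure \<nu> (U n)) \<longlonglongrightarrow> measure \<nu> (\<Inter>n. U n)"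
  proof (rule finite_Lim_measure_decseq)
    show "decseq U" unfolding decseq_def U_def by (intro allI impI UN_mono) auto
  qed (use U in auto)
  moreover have "e \<le> measure \<nu> (U n)" for n
    using s(1)[of n] finite_measure_mono[of "B (s n)" "U n"] U by (fastforce simp: U_def)
  ultimately show False using e unfolding 0 by (meson LIMSEQ_le_const not_less)
qed

section \<open>Overlaps of the canonical parts\<close>

lemma (in sigma_finite_measure) exists_finite_positive_subset:
  assumes B: "B \<in> sets M" "emeasure M B \<noteq> 0"
  obtains A where "A \<in> sets M" "A \<subseteq> B" "0 < emeasure M A" "emeasure M A < \<infinity>"
proof -
  obtain E :: "nat \<Rightarrow> 'a set" where E: "range E \<subseteq> sets M" "(\<Union>i. E i) = space M" "\<And>i. emeasure M (E i) \<noteq> \<infinity>" "incseq E"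
    using sigma_finite_incseq by metis
  have "\<exists>i::nat. emeasure M (B \<inter> E i) \<noteq> 0"
  proof (rule ccontr)
    assume "\<not> ?thesis"
    then have "(\<Union>i. B \<inter> E i) \<in> null_sets M"
      using E(1) B(1) by (intro null_sets_UN) auto
    moreover have "(\<Union>i. B \<inter> E i) = B"
      using E(2) sets.sets_into_space[OF B(1)] by auto
    ultimately show False using B(2) by auto
  qed
  then obtain i where i: "emeasure M (B \<inter> E i) \<noteq> 0" ..
  have "emeasure M (B \<inter> E i) \<le> emeasure M (E i)"
    using E(1) by (intro emeasure_mono) auto
  with E(3)[of i] have "emeasure M (B \<inter> E i) < \<infinity>" by (auto simp: less_top top_unique)
  with i E(1) B(1) show ?thesis
    by (intro that[of "B \<inter> E i"]) (auto simp: zero_less_iff_neq_zero)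
qed

text \<open>\<open>N0\<close> is an upper bound of the wandering sets modulo null sets: a wandering
  set never meets its later shifts, so a non-null piece of it in \<open>Np\<close> would violate the
  \<open>limsup\<close> condition. The least upper bound \<open>D\<close> then lies in
  \<open>N0\<close> modulo null sets.\<close>

lemma dissipative_part_zero_type:
  assumes Q: "sets Q = sets seq_space"
    and D: "is_dissipative_part Q D" and N: "is_zero_type_partition Q N0 Np"
  shows "D \<inter> Np \<in> null_sets Q"
proof -
  have N0: "N0 \<in> sets Q" "Np \<in> sets Q" and part: "N0 \<inter> Np = {}" "N0 \<union> Np = UNIV"
    using N by (auto simp: is_zero_type_partition_def invariant_set_def)
  have "A - N0 \<in> null_sets Q" if A: "wandering Q A" for A
  proof (rule ccontr)
    let ?B = "A - N0"
    assume "?B \<notin> null_sets Q"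
    moreover have B: "?B \<in> sets Q" using A N0 by (auto simp: wandering_def)
    ultimately have "emeasure Q ?B > 0" by (auto simp: null_sets_def zero_less_iff_neq_zero)
    moreover have "?B \<subseteq> Np" using part by auto
    ultimately have "limsup (\<lambda>k::nat. emeasure Q (?B \<inter> shift (int k) -` ?B)) > 0"
      using N B unfolding is_zero_type_partition_def by blast
    moreover have "emeasure Q (?B \<inter> shift (int k) -` ?B) = 0" if "k > 0" for k :: nat
    proof -
      have "shift 0 -` A \<inter> shift (int k) -` A = {}"
        using A that unfolding wandering_def disjoint_family_on_def by auto
      then have "?B \<inter> shift (int k) -` ?B = {}" by auto
      then show ?thesis by simp
    qed
    then have "(\<lambda>k::nat. emeasure Q (?B \<inter> shift (int k) -` ?B)) \<longlonglongrightarrow> 0"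
      by (intro tendsto_eventually eventually_mono[OF eventually_gt_at_top[of 0]]) auto
    then have "limsup (\<lambda>k::nat. emeasure Q (?B \<inter> shift (int k) -` ?B)) = 0"
      by (intro lim_imp_Limsup) auto
    ultimately show False by simp
  qed
  then have "D - N0 \<in> null_sets Q"
    using D N0(1) unfolding is_dissipative_part_def is_measurable_union_def by blast
  moreover have "D - N0 = D \<inter> Np" using part by auto
  ultimately show ?thesis by simp
qed

text \<open>A set of finite positive measure in the overlap has return measures tending to
  \<open>0\<close> under \<open>Q\<close>, hence under the invariant probability equivalent to
  \<open>Q\<close> on \<open>P\<close>. It has positive mass under that probability, so recurrence
  is contradicted.\<close>

lemma positive_part_zero_type:
  assumes Q: "sets Q = sets seq_space" "sigma_finite_measure Q"
    and P: "is_positive_null_partition Q P N" and N: "is_zero_type_partition Q N0 Np"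
  shows "P \<inter> N0 \<in> null_sets Q"
proof (rule ccontr)
  interpret sigma_finite_measure Q by fact
  assume null: "P \<inter> N0 \<notin> null_sets Q"
  have meas: "P \<in> sets Q" "N0 \<in> sets Q"
    using P N by (auto simp: is_positive_null_partition_def is_zero_type_partition_def invariant_set_def)
  with null have ne: "emeasure Q (P \<inter> N0) \<noteq> 0" by auto
  then obtain A where A: "A \<in> sets Q" "A \<subseteq> P \<inter> N0" "0 < emeasure Q A" "emeasure Q A < \<infinity>"
    using meas by (elim exists_finite_positive_subset[rotated]) auto
  have "emeasure Q P \<noteq> 0"
    using A emeasure_mono[of A P Q] meas by auto
  then obtain \<nu> where \<nu>: "invariant_prob \<nu>"
    and ac: "absolutely_continuous (restr Q P) \<nu>" "absolutely_continuous \<nu> (restr Q P)"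
    using P by (auto simp: is_positive_null_partition_def)
  interpret \<nu>: prob_space \<nu> using \<nu> by (simp add: invariant_prob_def)
  have \<nu>_sets: "sets \<nu> = sets Q" using \<nu> Q(1) by (simp add: invariant_prob_def)
  let ?B = "\<lambda>k::nat. A \<inter> shift (int k) -` A"
  have B: "?B k \<in> sets Q" for k
    using A(1) vimage_sets_seq[OF Q(1) measurable_shift A(1)] by auto
  have lim: "(\<lambda>k. emeasure Q (?B k)) \<longlonglongrightarrow> 0"
    using N A unfolding is_zero_type_partition_def by auto
  have "(\<lambda>k. measure \<nu> (?B k)) \<longlonglongrightarrow> 0"
  proof (rule absolutely_continuous_tendsto_0[OF \<nu>.finite_measure_axioms])
    show "absolutely_continuous Q \<nu>"
      unfolding absolutely_continuous_def
    proof
      fix Z assume Z: "Z \<in> null_sets Q"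
      then have "emeasure Q (P \<inter> Z) = 0" using meas null_set_Int1[of Z Q P] by (auto simp: Int_commute)
      then have "Z \<in> null_sets (restr Q P)" using Z meas by (auto simp: null_sets_def emeasure_restr)
      then show "Z \<in> null_sets \<nu>" using ac(1) by (auto simp: absolutely_continuous_def)
    qed
  qed (use \<nu>_sets B lim in auto)
  moreover have "measure \<nu> A > 0"
  proof (rule ccontr)
    assume "\<not> measure \<nu> A > 0"
    then have "measure \<nu> A = 0" using measure_nonneg[of \<nu> A] by linarith
    then have "A \<in> null_sets \<nu>" using A(1) \<nu>_sets
      by (auto simp: null_sets_def \<nu>.emeasure_eq_measure)
    then have "A \<in> null_sets (restr Q P)" using ac(2) by (auto simp: absolutely_continuous_def)
    then have "emeasure Q (P \<inter> A) = 0" using A(1) meas by (auto simp: null_sets_def emeasure_restr)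
    moreover have "P \<inter> A = A" using A by auto
    ultimately show False using A by simp
  qed
  ultimately show False
    using invariant_prob_recurrence[OF \<nu>] A(1) \<nu>_sets by auto
qed

section \<open>Invertible maps that commute with the shift and rescale the measure\<close>

locale commuting_symmetry = sigma_finite_measure Q
  for Q :: "(int \<Rightarrow> real) measure" +
  fixes f g :: "(int \<Rightarrow> real) \<Rightarrow> (int \<Rightarrow> real)" and c :: real
  assumes sets_Q: "sets Q = sets seq_space"
    and f_measurable: "f \<in> measurable seq_space seq_space"
    and g_measurable: "g \<in> measurable seq_space seq_space"
    and f_g: "f (g x) = x" and g_f: "g (f x) = x"
    and f_shift: "f (shift n x) = shift n (f x)"
    and c_pos: "0 < c"
    and Q_eq: "Q = scale_measure (ennreal c) (distr Q seq_space f)"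
begin

lemma space_Q: "space Q = UNIV"
  by (rule space_eq_UNIV_if_sets_seq[OF sets_Q])

lemma vimage_sets: "A \<in> sets Q \<Longrightarrow> f -` A \<in> sets Q"
  by (rule vimage_sets_seq[OF sets_Q f_measurable])

lemma emeasure_vimage:
  assumes "A \<in> sets Q"
  shows "emeasure Q A = ennreal c * emeasure Q (f -` A)"
proof -
  have f: "f \<in> measurable Q seq_space"
    by (subst measurable_cong_sets[OF sets_Q refl]) (rule f_measurable)
  have "emeasure Q A = emeasure (scale_measure (ennreal c) (distr Q seq_space f)) A"
    using Q_eq by simp
  also have "\<dots> = ennreal c * emeasure Q (f -` A)"
    using assms f by (simp add: emeasure_distr space_Q sets_Q)
  finally show ?thesis .
qed

lemma null_sets_vimage_iff:
  assumes "A \<in> sets Q"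
  shows "f -` A \<in> null_sets Q \<longleftrightarrow> A \<in> null_sets Q"
  using emeasure_vimage[OF assms] assms vimage_sets[OF assms] c_pos
  by (auto simp: null_sets_def)

lemma g_shift: "g (shift n x) = shift n (g x)"
  by (metis f_g g_f f_shift)

text \<open>This is why the inverse \<open>g\<close> is a parameter of the locale: each inclusion
  proved for \<open>f\<close> becomes available for \<open>g\<close> by interpretation.\<close>

lemma inverse: "commuting_symmetry Q g f (1 / c)"
proof unfold_locales
  show "Q = scale_measure (ennreal (1 / c)) (distr Q seq_space g)"
  proof (rule measure_eqI)
    fix A assume A: "A \<in> sets Q"
    have g: "g \<in> measurable Q seq_space"
      by (subst measurable_cong_sets[OF sets_Q refl]) (rule g_measurable)
    have "f -` (g -` A) = A" by (auto simp: g_f)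
    then have "emeasure Q (g -` A) = ennreal c * emeasure Q A"
      using emeasure_vimage[OF vimage_sets_seq[OF sets_Q g_measurable A]] by simp
    then have "emeasure (scale_measure (ennreal (1 / c)) (distr Q seq_space g)) A
        = ennreal (1 / c) * (ennreal c * emeasure Q A)"
      using A g by (simp add: emeasure_distr space_Q sets_Q)
    also have "\<dots> = emeasure Q A"
      using c_pos by (simp add: mult.assoc[symmetric] flip: ennreal_mult')
    finally show "emeasure Q A = emeasure (scale_measure (ennreal (1 / c)) (distr Q seq_space g)) A" ..
  qed (simp add: sets_Q)
qed (use c_pos in \<open>auto simp: sets_Q f_measurable g_measurable f_g g_f g_shift\<close>)

text \<open>Points outside \<open>A\<close> that \<open>f\<close> sends into \<open>A\<close> form
  the preimage under \<open>f\<close> of the points of \<open>A\<close> that \<open>g\<close> sends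
  outside \<open>A\<close>, and preimages under \<open>f\<close> of null sets are null.\<close>

lemma almost_invariantI:
  assumes A: "A \<in> sets Q" and "A - f -` A \<in> null_sets Q" and "A - g -` A \<in> null_sets Q"
  shows "AE x in Q. x \<in> A \<longleftrightarrow> f x \<in> A"
proof -
  have "f -` (A - g -` A) = f -` A - A" by (auto simp: g_f)
  moreover have "A - g -` A \<in> sets Q" using assms by auto
  ultimately have "f -` A - A \<in> null_sets Q"
    using assms(3) null_sets_vimage_iff by metis
  from AE_not_in[OF this] AE_not_in[OF assms(2)] show ?thesis
    by eventually_elim auto
qed

text \<open>\<open>f\<close> rescales the mass of the intersection of \<open>A\<close> and
  \<open>B\<close>, and the preimage of \<open>A\<close> may be replaced by \<open>A\<close> up to a
  null set. For the shift this is invariance of the restricted measure, for a scaling it is the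
  stability relation.\<close>

lemma restr_scale_distr:
  assumes A: "A \<in> sets Q" and inv: "AE x in Q. x \<in> A \<longleftrightarrow> f x \<in> A"
  shows "restr Q A = scale_measure (ennreal c) (distr (restr Q A) seq_space f)"
proof (rule measure_eqI)
  fix B assume "B \<in> sets (restr Q A)"
  then have B: "B \<in> sets Q" by simp
  have f: "f \<in> measurable (restr Q A) seq_space"
    by (subst measurable_cong_sets[OF _ refl, where M'=seq_space]) (simp_all add: f_measurable sets_Q)
  have "emeasure (restr Q A) B = ennreal c * emeasure Q (f -` (A \<inter> B))"
    using A B by (simp add: emeasure_restr emeasure_vimage[of "A \<inter> B"])
  also have "emeasure Q (f -` (A \<inter> B)) = emeasure Q (A \<inter> f -` B)"
    using inv A B vimage_sets by (intro emeasure_eq_AE) auto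
  also have "ennreal c * \<dots> = emeasure (scale_measure (ennreal c) (distr (restr Q A) seq_space f)) B"
    using A B f vimage_sets[OF B] by (simp add: emeasure_distr emeasure_restr space_Q sets_Q)
  finally show "emeasure (restr Q A) B = \<dots>" .
qed (simp add: sets_Q)

lemma wandering_vimage:
  assumes "wandering Q A"
  shows "wandering Q (g -` A)"
  using assms vimage_sets_seq[OF sets_Q g_measurable]
  unfolding wandering_def disjoint_family_on_def by (fastforce simp: g_shift)

text \<open>The preimage of \<open>D\<close> under \<open>f\<close> is again an upper bound of the
  wandering sets, because \<open>f\<close> carries wandering sets to wandering sets; leastness of
  \<open>D\<close> concludes.\<close>

lemma dissipative_part_Diff_null:
  assumes D: "is_dissipative_part Q D"
  shows "D - f -` D \<in> null_sets Q"
proof -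
  have D_sets: "D \<in> sets Q" and D_ub: "\<And>A. wandering Q A \<Longrightarrow> A - D \<in> null_sets Q"
    and D_lub: "\<And>V. V \<in> sets Q \<Longrightarrow> (\<And>A. wandering Q A \<Longrightarrow> A - V \<in> null_sets Q) \<Longrightarrow> D - V \<in> null_sets Q"
    using D by (auto simp: is_dissipative_part_def is_measurable_union_def)
  show ?thesis
  proof (rule D_lub[OF vimage_sets[OF D_sets]])
    fix A assume A: "wandering Q A"
    have 1: "g -` A - D \<in> null_sets Q" by (rule D_ub[OF wandering_vimage[OF A]])
    then have "f -` (g -` A - D) \<in> null_sets Q"
      by (subst null_sets_vimage_iff) auto
    moreover have "f -` (g -` A - D) = A - f -` D" by (auto simp: g_f)
    ultimately show "A - f -` D \<in> null_sets Q" by simp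
  qed
qed

text \<open>If \<open>f\<close> moved a non-null piece of \<open>N0\<close> into \<open>Np\<close>,
  its image would have return measures equal to \<open>c\<close> times those of the piece. These
  tend to \<open>0\<close> by the zero type of \<open>N0\<close>, contrary to the
  \<open>limsup\<close> condition on \<open>Np\<close>.\<close>

lemma zero_type_Diff_null:
  assumes N: "is_zero_type_partition Q N0 Np"
  shows "N0 - f -` N0 \<in> null_sets Q"
proof (rule ccontr)
  have N0: "N0 \<in> sets Q" "Np \<in> sets Q" and part: "N0 \<inter> Np = {}" "N0 \<union> Np = UNIV"
    and zero: "\<And>A. A \<in> sets Q \<Longrightarrow> A \<subseteq> N0 \<Longrightarrow> 0 < emeasure Q A \<Longrightarrow> emeasure Q A < \<infinity> \<Longrightarrow>
        (\<lambda>k::nat. emeasure Q (A \<inter> shift (int k) -` A)) \<longlonglongrightarrow> 0"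
    and pos: "\<And>A. A \<in> sets Q \<Longrightarrow> A \<subseteq> Np \<Longrightarrow> 0 < emeasure Q A \<Longrightarrow>
        limsup (\<lambda>k::nat. emeasure Q (A \<inter> shift (int k) -` A)) > 0"
    using N by (auto simp: is_zero_type_partition_def invariant_set_def)
  interpret G: commuting_symmetry Q g f "1 / c" by (rule inverse)
  assume "N0 - f -` N0 \<notin> null_sets Q"
  moreover have meas: "N0 - f -` N0 \<in> sets Q" using N0 vimage_sets by auto
  ultimately have "emeasure Q (N0 - f -` N0) \<noteq> 0" by auto
  then obtain A where A: "A \<in> sets Q" "A \<subseteq> N0 - f -` N0" "0 < emeasure Q A" "emeasure Q A < \<infinity>"
    by (rule exists_finite_positive_subset[OF meas])
  have A_k: "A \<inter> shift (int k) -` A \<in> sets Q" for k :: nat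
    using A(1) vimage_sets_seq[OF sets_Q measurable_shift A(1)] by auto
  have lim: "(\<lambda>k::nat. emeasure Q (A \<inter> shift (int k) -` A)) \<longlonglongrightarrow> 0"
    using A by (intro zero) auto
  \<comment> \<open>The image of \<open>A\<close> under \<open>f\<close>, written as a preimage
    under the inverse so that measurability is immediate.\<close>
  let ?B = "g -` A"
  have vim: "emeasure Q (g -` C) = ennreal c * emeasure Q C" if "C \<in> sets Q" for C
  proof -
    have "f -` (g -` C) = C" by (auto simp: g_f)
    then show ?thesis using emeasure_vimage[OF G.vimage_sets[OF that]] by simp
  qed
  have "?B \<inter> shift (int k) -` ?B = g -` (A \<inter> shift (int k) -` A)" for k :: nat
    by (auto simp: g_shift)
  then have "emeasure Q (?B \<inter> shift (int k) -` ?B) = ennreal c * emeasure Q (A \<inter> shift (int k) -` A)" for k :: nat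
    using vim[OF A_k] by simp
  moreover have "(\<lambda>k::nat. ennreal c * emeasure Q (A \<inter> shift (int k) -` A)) \<longlonglongrightarrow> ennreal c * 0"
    by (rule ennreal_tendsto_cmult[OF _ lim]) simp
  ultimately have "(\<lambda>k::nat. emeasure Q (?B \<inter> shift (int k) -` ?B)) \<longlonglongrightarrow> 0" by simp
  then have "limsup (\<lambda>k::nat. emeasure Q (?B \<inter> shift (int k) -` ?B)) = 0"
    by (intro lim_imp_Limsup) auto
  moreover have "limsup (\<lambda>k::nat. emeasure Q (?B \<inter> shift (int k) -` ?B)) > 0"
  proof (rule pos)
    show "?B \<subseteq> Np"
    proof
      fix x assume "x \<in> ?B"
      then have "x \<notin> N0" using A(2) by (auto simp: f_g)
      then show "x \<in> Np" using part by auto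
    qed
    show "0 < emeasure Q ?B"
      using A(3) c_pos unfolding vim[OF A(1)] by (simp add: ennreal_zero_less_mult_iff)
  qed (use A G.vimage_sets in auto)
  ultimately show False by simp
qed

text \<open>If \<open>f\<close> moved a non-null piece of \<open>P\<close> into \<open>N\<close>,
  the invariant probability living on \<open>P\<close> could be conditioned on the points sent into
  \<open>N\<close> and transported by \<open>f\<close>. The result would be an invariant probability
  absolutely continuous with respect to \<open>Q\<close> on \<open>N\<close>, which is
  excluded.\<close>

lemma positive_part_Diff_null:
  assumes P: "is_positive_null_partition Q P N"
  shows "P - f -` P \<in> null_sets Q"
proof (rule ccontr)
  have meas: "P \<in> sets Q" "N \<in> sets Q" and part: "P \<inter> N = {}" "P \<union> N = UNIV"
    and N_inv: "shift 1 -` N = N"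
    and P_prob: "emeasure Q P = 0 \<or> (\<exists>\<nu>. invariant_prob \<nu> \<and>
           absolutely_continuous (restr Q P) \<nu> \<and> absolutely_continuous \<nu> (restr Q P))"
    and N_no: "\<And>\<nu>. invariant_prob \<nu> \<Longrightarrow> \<not> absolutely_continuous (restr Q N) \<nu>"
    using P by (auto simp: is_positive_null_partition_def invariant_set_def)
  have fN: "f -` N \<in> sets Q" by (rule vimage_sets[OF meas(2)])
  have diff: "P - f -` P = P \<inter> f -` N" using part by auto
  assume "P - f -` P \<notin> null_sets Q"
  then have ne: "emeasure Q (P \<inter> f -` N) \<noteq> 0" using meas fN unfolding diff by auto
  then have "emeasure Q P \<noteq> 0"
    using emeasure_mono[of "P \<inter> f -` N" P Q] meas by auto
  with P_prob obtain \<nu> where \<nu>: "invariant_prob \<nu>"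
    and ac: "absolutely_continuous (restr Q P) \<nu>" "absolutely_continuous \<nu> (restr Q P)" by auto
  interpret \<nu>: prob_space \<nu> using \<nu> by (simp add: invariant_prob_def)
  have \<nu>_sets: "sets \<nu> = sets seq_space" "sets \<nu> = sets Q" and \<nu>_inv: "shift_invariant \<nu>"
    using \<nu> sets_Q by (auto simp: invariant_prob_def)
  \<comment> \<open>Conditioning needs positive mass; it comes from \<open>restr Q P\<close> being
    absolutely continuous with respect to \<open>\<nu>\<close>.\<close>
  have pos: "emeasure \<nu> (f -` N) \<noteq> 0"
  proof
    assume "emeasure \<nu> (f -` N) = 0"
    then have "f -` N \<in> null_sets \<nu>" using fN \<nu>_sets by auto
    then have "f -` N \<in> null_sets (restr Q P)" using ac(2) by (auto simp: absolutely_continuous_def)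
    then have "emeasure Q (P \<inter> f -` N) = 0" using fN meas by (auto simp: null_sets_def emeasure_restr)
    with ne show False ..
  qed
  define \<nu>' where "\<nu>' = distr (uniform_measure \<nu> (f -` N)) seq_space f"
  have f_unif: "f \<in> measurable (uniform_measure \<nu> (f -` N)) seq_space"
    by (subst measurable_cong_sets[OF _ refl, where M'=seq_space]) (simp_all add: \<nu>_sets f_measurable sets_Q)
  have \<nu>'_sets: "sets \<nu>' = sets seq_space" by (simp add: \<nu>'_def)
  have em: "emeasure \<nu>' B = emeasure \<nu> (f -` N \<inter> f -` B) / emeasure \<nu> (f -` N)" if "B \<in> sets Q" for B
    unfolding \<nu>'_def using that fN vimage_sets[OF that] f_unif
    by (subst emeasure_distr) (simp_all add: sets_Q[symmetric] \<nu>_sets(2) space_eq_UNIV_if_sets_seq[OF \<nu>_sets(1)])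
  have "invariant_prob \<nu>'"
    unfolding invariant_prob_def
  proof (intro conjI \<nu>'_sets)
    have "prob_space (uniform_measure \<nu> (f -` N))"
      using pos by (intro prob_space_uniform_measure) auto
    then show "prob_space \<nu>'" unfolding \<nu>'_def by (rule prob_space.prob_space_distr) (rule f_unif)
    show "shift_invariant \<nu>'"
      unfolding shift_invariant_def
    proof (rule measure_eqI)
      fix B assume "B \<in> sets (distr \<nu>' seq_space (shift 1))"
      then have B: "B \<in> sets Q" by (simp add: sets_Q)
      have sB: "shift 1 -` B \<in> sets Q" by (rule vimage_sets_seq[OF sets_Q measurable_shift B])
      have "shift 1 \<in> measurable \<nu>' seq_space"
        by (subst measurable_cong_sets[OF \<nu>'_sets refl]) (rule measurable_shift)
      then have "emeasure (distr \<nu>' seq_space (shift 1)) B = emeasure \<nu>' (shift 1 -` B)"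
        using B by (subst emeasure_distr) (simp_all add: sets_Q space_eq_UNIV_if_sets_seq[OF \<nu>'_sets])
      also have "\<dots> = emeasure \<nu> (f -` N \<inter> f -` shift 1 -` B) / emeasure \<nu> (f -` N)"
        by (rule em[OF sB])
      also have "f -` N \<inter> f -` shift 1 -` B = shift (int 1) -` (f -` N \<inter> f -` B)"
      proof -
        \<comment> \<open>\<open>N\<close> is strictly invariant and \<open>f\<close> commutes with
          the shift, so the set conditioned on is strictly invariant too.\<close>
        have "f -` N = shift 1 -` (f -` N)"
          by (subst N_inv[symmetric]) (auto simp: f_shift)
        then show ?thesis by (auto simp: f_shift)
      qed
      also have "emeasure \<nu> \<dots> = emeasure \<nu> (f -` N \<inter> f -` B)"
        by (rule emeasure_shift_vimage[OF \<nu>_sets(1) \<nu>_inv]) (use fN vimage_sets[OF B] \<nu>_sets in auto)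
      also have "\<dots> / emeasure \<nu> (f -` N) = emeasure \<nu>' B" by (rule em[OF B, symmetric])
      finally show "emeasure (distr \<nu>' seq_space (shift 1)) B = emeasure \<nu>' B" .
    qed (simp add: \<nu>'_sets)
  qed
  moreover have "absolutely_continuous (restr Q N) \<nu>'"
    unfolding absolutely_continuous_def
  proof
    fix B assume B: "B \<in> null_sets (restr Q N)"
    then have B_sets: "B \<in> sets Q" by auto
    have "N \<inter> B \<in> null_sets Q" using B meas by (auto simp: null_sets_def emeasure_restr)
    then have "f -` (N \<inter> B) \<in> null_sets Q" by (subst null_sets_vimage_iff) auto
    then have "f -` N \<inter> f -` B \<in> null_sets Q" by (simp add: vimage_Int)
    then have "f -` N \<inter> f -` B \<in> null_sets (restr Q P)"
      using meas null_set_Int1[of "f -` N \<inter> f -` B" Q P]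
      by (auto simp: null_sets_def emeasure_restr Int_commute)
    then have "f -` N \<inter> f -` B \<in> null_sets \<nu>" using ac(1) by (auto simp: absolutely_continuous_def)
    then show "B \<in> null_sets \<nu>'"
      using B_sets by (auto simp: null_sets_def em \<nu>'_sets sets_Q)
  qed
  ultimately show False using N_no by blast
qed

lemma dissipative_part_almost_invariant:
  assumes "is_dissipative_part Q D"
  shows "AE x in Q. x \<in> D \<longleftrightarrow> f x \<in> D"
proof (rule almost_invariantI)
  interpret G: commuting_symmetry Q g f "1 / c" by (rule inverse)
  show "D - f -` D \<in> null_sets Q" "D - g -` D \<in> null_sets Q"
    using assms by (rule dissipative_part_Diff_null G.dissipative_part_Diff_null)+
qed (use assms in \<open>auto simp: is_dissipative_part_def is_measurable_union_def\<close>)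

lemma zero_type_almost_invariant:
  assumes "is_zero_type_partition Q N0 Np"
  shows "AE x in Q. x \<in> N0 \<longleftrightarrow> f x \<in> N0"
proof (rule almost_invariantI)
  interpret G: commuting_symmetry Q g f "1 / c" by (rule inverse)
  show "N0 - f -` N0 \<in> null_sets Q" "N0 - g -` N0 \<in> null_sets Q"
    using assms by (rule zero_type_Diff_null G.zero_type_Diff_null)+
qed (use assms in \<open>auto simp: is_zero_type_partition_def invariant_set_def\<close>)

lemma positive_part_almost_invariant:
  assumes "is_positive_null_partition Q P N"
  shows "AE x in Q. x \<in> P \<longleftrightarrow> f x \<in> P"
proof (rule almost_invariantI)
  interpret G: commuting_symmetry Q g f "1 / c" by (rule inverse)
  show "P - f -` P \<in> null_sets Q" "P - g -` P \<in> null_sets Q"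
    using assms by (rule positive_part_Diff_null G.positive_part_Diff_null)+
qed (use assms in \<open>auto simp: is_positive_null_partition_def invariant_set_def\<close>)

end

section \<open>Stationary IDp laws and convolution\<close>

text \<open>The definition bounds coordinate \<open>0\<close> only; shift invariance moves the bound
  one index at a time in both directions.\<close>

lemma stationary_levy_measure_coord:
  assumes "stationary_levy_measure Q"
  shows "(\<integral>\<^sup>+ x. ennreal (min ((x i)\<^sup>2) 1) \<partial>Q) < \<infinity>"
proof -
  have Q: "sets Q = sets seq_space" "distr Q seq_space (shift 1) = Q"
    using assms by (auto simp: stationary_levy_measure_def shift_invariant_def)
  note [measurable_cong] = Q(1)
  let ?K = "\<lambda>i. \<integral>\<^sup>+ x. ennreal (min ((x i)\<^sup>2) 1) \<partial>Q"
  have step: "?K (i + 1) = ?K i" for i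
  proof -
    have "?K i = (\<integral>\<^sup>+ x. ennreal (min ((x i)\<^sup>2) 1) \<partial>distr Q seq_space (shift 1))"
      by (simp only: Q(2))
    also have "\<dots> = ?K (i + 1)" by (subst nn_integral_distr) (auto simp: shift_def)
    finally show ?thesis ..
  qed
  have "?K i = ?K 0"
  proof (induction i rule: int_induct[where k=0])
    case (step1 i)
    then show ?case using step[of i] by simp
  next
    case (step2 i)
    then show ?case using step[of "i - 1"] by simp
  qed simp
  then show ?thesis using assms by (simp add: stationary_levy_measure_def)
qed

lemma pairing_shift: "pairing (shift (- 1) a) x = pairing a (shift 1 x)"
  unfolding pairing_def shift_def
  by (rule sum.reindex_bij_witness[of _ "\<lambda>i. i + 1" "\<lambda>i. i - 1"]) auto

lemma finite_support_shift:
  assumes "finite {i. a i \<noteq> 0}"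
  shows "finite {i. shift n a i \<noteq> 0}"
proof -
  have "{i. shift n a i \<noteq> 0} = (\<lambda>i. i - n) ` {i. a i \<noteq> 0}"
    by (auto simp: shift_def image_iff intro!: exI[of _ "_ + n"])
  then show ?thesis using assms by simp
qed

lemma is_idp_law_of_iff:
  "is_idp_law_of Q P \<longleftrightarrow> stationary_levy_measure Q \<and> prob_space P \<and> sets P = sets seq_space \<and>
     shift_invariant P \<and> (\<forall>a. finite {i. a i \<noteq> 0} \<longrightarrow> char_fun P a = exp (CLINT x|Q. lk_integrand a x))"
  by (simp add: is_idp_law_of_def char_fun_def lk_integrand_def)

lemma is_idp_law_of_unique:
  "is_idp_law_of Q P \<Longrightarrow> is_idp_law_of Q P' \<Longrightarrow> P = P'"
  unfolding is_idp_law_of_iff by (intro char_fun_unique) auto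

text \<open>Stationarity need not be arranged in the construction: the exponent inherits shift
  invariance from \<open>Q\<close>, and the characteristic functional determines the law.\<close>

lemma is_idp_law_of_if_char_fun:
  assumes Q: "stationary_levy_measure Q" and P: "prob_space P" "sets P = sets seq_space"
    and cf: "\<And>a. finite {i. a i \<noteq> 0} \<Longrightarrow> char_fun P a = exp (CLINT x|Q. lk_integrand a x)"
  shows "is_idp_law_of Q P"
proof -
  interpret prob_space P by fact
  have Q': "sets Q = sets seq_space" "distr Q seq_space (shift 1) = Q"
    using Q by (auto simp: stationary_levy_measure_def shift_invariant_def)
  note [measurable_cong] = P(2) Q'(1)
  have "distr P seq_space (shift 1) = P"
  proof (rule char_fun_unique)
    show "prob_space (distr P seq_space (shift 1))" by (rule prob_space_distr) measurable
    fix a :: "int \<Rightarrow> real" assume a: "finite {i. a i \<noteq> 0}"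
    have "char_fun (distr P seq_space (shift 1)) a = char_fun P (shift (- 1) a)"
      unfolding char_fun_def by (subst integral_distr) (simp_all add: pairing_shift)
    also have "\<dots> = exp (CLINT x|Q. lk_integrand (shift (- 1) a) x)"
      by (rule cf[OF finite_support_shift[OF a]])
    also have "(CLINT x|Q. lk_integrand (shift (- 1) a) x) = (CLINT x|Q. lk_integrand a (shift 1 x))"
    proof -
      have "clip (shift 1 x) = shift 1 (clip x)" for x by (simp add: clip_def shift_def)
      then show ?thesis by (simp add: lk_integrand_def pairing_shift)
    qed
    also have "\<dots> = (CLINT x|distr Q seq_space (shift 1). lk_integrand a x)"
      by (subst integral_distr) simp_all
    also have "exp \<dots> = char_fun P a" unfolding Q'(2) by (rule cf[OF a, symmetric])
    finally show "char_fun (distr P seq_space (shift 1)) a = char_fun P a" .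
  qed (use P in auto)
  then show ?thesis using Q P cf by (simp add: is_idp_law_of_iff shift_invariant_def)
qed

text \<open>Existence and uniqueness together make the definite description denote a law with the
  intended properties.\<close>

lemma is_idp_law_of_idp_law:
  assumes Q: "stationary_levy_measure Q"
  shows "is_idp_law_of Q (idp_law Q)"
proof -
  obtain P where "prob_space P" "sets P = sets seq_space"
    "\<And>a. finite {i. a i \<noteq> 0} \<Longrightarrow> char_fun P a = exp (CLINT x|Q. lk_integrand a x)"
  proof (rule idp_law_exists)
    show "sets Q = sets seq_space" "sigma_finite_measure Q"
      using Q by (auto simp: stationary_levy_measure_def)
  qed (use stationary_levy_measure_coord[OF Q] in auto)
  then have P: "is_idp_law_of Q P" by (rule is_idp_law_of_if_char_fun[OF Q])
  show ?thesis unfolding idp_law_def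
    by (rule theI, rule P) (erule is_idp_law_of_unique, rule P)
qed

lemma seq_convolution:
  assumes "prob_space M" and M: "sets M = sets seq_space"
    and "prob_space N" and N: "sets N = sets seq_space"
  shows "prob_space (M \<star>\<^sub>s N)" and "sets (M \<star>\<^sub>s N) = sets seq_space"
    and "char_fun (M \<star>\<^sub>s N) a = char_fun M a * char_fun N a"
proof -
  interpret M: prob_space M by fact
  interpret N: prob_space N by fact
  interpret MN: pair_prob_space M N ..
  note [measurable_cong] = M N
  have add: "(\<lambda>(x, y) i. x i + y i) \<in> measurable (M \<Otimes>\<^sub>M N) seq_space"
    unfolding case_prod_beta by (rule measurable_abs_UNIV) measurable
  show "prob_space (M \<star>\<^sub>s N)"
    unfolding seq_convolution_def by (rule MN.prob_space_distr[OF add])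
  show "sets (M \<star>\<^sub>s N) = sets seq_space" by (simp add: seq_convolution_def)
  have pa: "pairing a (\<lambda>i. x i + y i) = pairing a x + pairing a y" for x y
    by (simp add: pairing_def distrib_left sum.distrib)
  have "char_fun (M \<star>\<^sub>s N) a = (CLINT p|M \<Otimes>\<^sub>M N. iexp (pairing a (fst p)) * iexp (pairing a (snd p)))"
    unfolding char_fun_def seq_convolution_def
    by (subst integral_distr[OF add]) (simp_all add: case_prod_beta pa distrib_left exp_add)
  also have "\<dots> = (CLINT x|M. CLINT y|N. iexp (pairing a x) * iexp (pairing a y))"
    by (subst MN.integral_fst'[symmetric]) (auto intro!: MN.integrable_const_bound[of _ 1] simp: norm_mult)
  also have "\<dots> = char_fun M a * char_fun N a" by (simp add: char_fun_def)
  finally show "char_fun (M \<star>\<^sub>s N) a = char_fun M a * char_fun N a" .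
qed

section \<open>Stability of the four factors\<close>

lemma commuting_symmetry_shift:
  assumes Q: "stationary_levy_measure Q"
  shows "commuting_symmetry Q (shift 1) (shift (- 1)) 1"
proof -
  interpret sigma_finite_measure Q using Q by (simp add: stationary_levy_measure_def)
  show ?thesis
    by unfold_locales
       (use Q in \<open>auto simp: stationary_levy_measure_def shift_invariant_def shift_shift ac_simps\<close>)
qed

lemma commuting_symmetry_scale:
  assumes Q: "stationary_levy_measure Q" and b: "b > 0" and inv: "scaling_invariant \<alpha> b Q"
  shows "commuting_symmetry Q (scale_seq b) (scale_seq (1 / b)) (b powr - \<alpha>)"
proof -
  interpret sigma_finite_measure Q using Q by (simp add: stationary_levy_measure_def)
  show ?thesis
  proof unfold_locales
    show "Q = scale_measure (ennreal (b powr - \<alpha>)) (distr Q seq_space (scale_seq b))"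
      using inv by (simp only: scaling_invariant_def)
  qed (use Q b in \<open>auto simp: stationary_levy_measure_def shift_scale_seq\<close>, auto simp: scale_seq_def)
qed

text \<open>Invariance of \<open>A\<close> modulo null sets already makes the restricted measure
  exactly shift-invariant; the remaining conditions pass to any smaller measure.\<close>

lemma stationary_levy_measure_restr:
  assumes Q: "stationary_levy_measure Q" and A: "A \<in> sets Q"
    and inv: "AE x in Q. x \<in> A \<longleftrightarrow> shift 1 x \<in> A"
  shows "stationary_levy_measure (restr Q A)"
proof -
  have Q': "sets Q = sets seq_space" "sigma_finite_measure Q" "emeasure Q {\<lambda>_. 0} = 0"
    "(\<integral>\<^sup>+ x. ennreal (min ((x 0)\<^sup>2) 1) \<partial>Q) < \<infinity>"
    using Q by (auto simp: stationary_levy_measure_def)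
  note [measurable_cong] = Q'(1)
  interpret commuting_symmetry Q "shift 1" "shift (- 1)" 1 by (rule commuting_symmetry_shift[OF Q])
  have le: "emeasure (restr Q A) B \<le> emeasure Q B" if "B \<in> sets Q" for B
    using that A by (simp add: emeasure_restr emeasure_mono)
  have "sigma_finite_measure (restr Q A)"
  proof
    obtain E :: "nat \<Rightarrow> _" where E: "range E \<subseteq> sets Q" "(\<Union>i. E i) = space Q" "\<And>i. emeasure Q (E i) \<noteq> \<infinity>" "incseq E"
      using sigma_finite_incseq by metis
    show "\<exists>F. countable F \<and> F \<subseteq> sets (restr Q A) \<and> \<Union> F = space (restr Q A) \<and> (\<forall>a\<in>F. emeasure (restr Q A) a \<noteq> \<infinity>)"
    proof (intro exI[of _ "range E"] conjI ballI)
      fix B assume "B \<in> range E"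
      then have "B \<in> sets Q" "emeasure Q B \<noteq> \<infinity>" using E by auto
      with le[of B] show "emeasure (restr Q A) B \<noteq> \<infinity>" by (auto simp: top_unique)
    qed (use E in auto)
  qed
  moreover have "shift_invariant (restr Q A)"
    using restr_scale_distr[OF A inv] by (simp add: shift_invariant_def)
  moreover have "emeasure (restr Q A) {\<lambda>_. 0} = 0"
  \<comment> \<open>Measurability of the singleton is not examined: \<open>emeasure\<close> is
    \<open>0\<close> by default on a non-measurable set.\<close>
  proof (cases "{\<lambda>_. 0} \<in> sets Q")
    case True
    with le[OF True] Q'(3) show ?thesis by simp
  qed (simp add: emeasure_notin_sets)
  moreover have "(\<integral>\<^sup>+ x. ennreal (min ((x 0)\<^sup>2) 1) \<partial>restr Q A) \<le> (\<integral>\<^sup>+ x. ennreal (min ((x 0)\<^sup>2) 1) \<partial>Q)"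
    using A by (subst nn_integral_restr) (auto intro!: nn_integral_mono split: split_indicator)
  ultimately show ?thesis
    using Q'(1,4) by (auto simp: stationary_levy_measure_def)
qed

text \<open>The hypothesis \<open>inv\<close> is applied to the shift, which makes the restriction a
  stationary Levy measure, and to every scaling, which makes its law stable.\<close>

lemma stable_law_restr:
  assumes Q: "stationary_levy_measure Q" and A: "A \<in> sets Q"
    and scaling: "\<forall>b>0. scaling_invariant \<alpha> b Q"
    and inv: "\<And>f g c. commuting_symmetry Q f g c \<Longrightarrow> AE x in Q. x \<in> A \<longleftrightarrow> f x \<in> A"
  shows "stationary_levy_measure (restr Q A)" and "stable_law \<alpha> (restr Q A) (idp_law (restr Q A))"
proof -
  show levy: "stationary_levy_measure (restr Q A)"
    by (rule stationary_levy_measure_restr[OF Q A inv[OF commuting_symmetry_shift[OF Q]]])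
  show "stable_law \<alpha> (restr Q A) (idp_law (restr Q A))"
    unfolding stable_law_def semi_stable_law_def
  proof (intro allI impI conjI is_idp_law_of_idp_law[OF levy])
    fix b :: real assume b: "b > 0"
    interpret commuting_symmetry Q "scale_seq b" "scale_seq (1 / b)" "b powr - \<alpha>"
      using scaling b by (intro commuting_symmetry_scale[OF Q]) auto
    show "scaling_invariant \<alpha> b (restr Q A)"
      unfolding scaling_invariant_def
      by (rule restr_scale_distr[OF A inv]) (rule commuting_symmetry_axioms)
  qed
qed

theorem corollary8p4:
  fixes \<alpha> :: real
    and Q Q_B Q_m Q_wm Q_ne :: "(int \<Rightarrow> real) measure"
    and D C P N N0 Np :: "(int \<Rightarrow> real) set"
  assumes "0 < \<alpha>" and "\<alpha> < 2"
    and "stationary_levy_measure Q"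
    and "\<forall>b>0. scaling_invariant \<alpha> b Q"
    and "is_dissipative_part Q D" and "C = UNIV - D"
    and "is_positive_null_partition Q P N"
    and "is_zero_type_partition Q N0 Np"
    and "Q_B = restr Q D"
    and "Q_m = restr Q (N0 \<inter> C)"
    and "Q_wm = restr Q (Np \<inter> N)"
    and "Q_ne = restr Q P"
  shows "stable_law \<alpha> Q (idp_law Q)
    \<and> idp_law Q = idp_law Q_B \<star>\<^sub>s idp_law Q_m \<star>\<^sub>s idp_law Q_wm \<star>\<^sub>s idp_law Q_ne
    \<and> stable_law \<alpha> Q_B (idp_law Q_B)
    \<and> stable_law \<alpha> Q_m (idp_law Q_m)
    \<and> stable_law \<alpha> Q_wm (idp_law Q_wm)
    \<and> stable_law \<alpha> Q_ne (idp_law Q_ne)"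
proof -
  note Q = assms(3) and scaling = assms(4) and D = assms(5) and P = assms(7) and N0 = assms(8)
  have Q_sets: "sets Q = sets seq_space" and Q_sf: "sigma_finite_measure Q"
    using Q by (auto simp: stationary_levy_measure_def)
  note [measurable_cong] = Q_sets
  have meas[measurable]: "D \<in> sets Q" "P \<in> sets Q" "N \<in> sets Q" "N0 \<in> sets Q" "Np \<in> sets Q"
    using D P N0 by (auto simp: is_dissipative_part_def is_measurable_union_def
        is_positive_null_partition_def is_zero_type_partition_def invariant_set_def)
  have C: "N0 \<inter> C = N0 - D" using assms(6) by auto
  have "P \<inter> N = {}" "P \<union> N = UNIV" "N0 \<inter> Np = {}" "N0 \<union> Np = UNIV"
    using P N0 by (auto simp only: is_positive_null_partition_def is_zero_type_partition_def)
  then have compl: "x \<in> N \<longleftrightarrow> x \<notin> P" "x \<in> Np \<longleftrightarrow> x \<notin> N0" for x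
    by blast+
  have sets_parts: "N0 \<inter> C \<in> sets Q" "Np \<inter> N \<in> sets Q" unfolding C by auto
  have inv_m: "AE x in Q. x \<in> N0 \<inter> C \<longleftrightarrow> f x \<in> N0 \<inter> C" if "commuting_symmetry Q f g c" for f g c
    using commuting_symmetry.dissipative_part_almost_invariant[OF that D]
      commuting_symmetry.zero_type_almost_invariant[OF that N0]
    unfolding C by eventually_elim auto
  have inv_wm: "AE x in Q. x \<in> Np \<inter> N \<longleftrightarrow> f x \<in> Np \<inter> N" if "commuting_symmetry Q f g c" for f g c
    using commuting_symmetry.positive_part_almost_invariant[OF that P]
      commuting_symmetry.zero_type_almost_invariant[OF that N0]
    by eventually_elim (auto simp: compl)
  have B: "stationary_levy_measure Q_B" "stable_law \<alpha> Q_B (idp_law Q_B)"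
    unfolding assms(9)
    by (rule stable_law_restr[OF Q meas(1) scaling commuting_symmetry.dissipative_part_almost_invariant[OF _ D]], assumption)+
  have ne: "stationary_levy_measure Q_ne" "stable_law \<alpha> Q_ne (idp_law Q_ne)"
    unfolding assms(12)
    by (rule stable_law_restr[OF Q meas(2) scaling commuting_symmetry.positive_part_almost_invariant[OF _ P]], assumption)+
  have m: "stationary_levy_measure Q_m" "stable_law \<alpha> Q_m (idp_law Q_m)"
    unfolding assms(10)
    by (rule stable_law_restr[OF Q sets_parts(1) scaling inv_m], assumption)+
  have wm: "stationary_levy_measure Q_wm" "stable_law \<alpha> Q_wm (idp_law Q_wm)"
    unfolding assms(11)
    by (rule stable_law_restr[OF Q sets_parts(2) scaling inv_wm], assumption)+
  have law: "prob_space (idp_law R)" "sets (idp_law R) = sets seq_space"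
    and law_cf: "\<And>a. finite {i. a i \<noteq> 0} \<Longrightarrow> char_fun (idp_law R) a = exp (CLINT x|R. lk_integrand a x)"
    if "stationary_levy_measure R" for R
    using is_idp_law_of_idp_law[OF that] by (auto simp: is_idp_law_of_iff)
  note conv1 = seq_convolution[OF law[OF B(1)] law[OF m(1)]]
  note conv2 = seq_convolution[OF conv1(1,2) law[OF wm(1)]]
  note conv3 = seq_convolution[OF conv2(1,2) law[OF ne(1)]]
  have "idp_law Q = idp_law Q_B \<star>\<^sub>s idp_law Q_m \<star>\<^sub>s idp_law Q_wm \<star>\<^sub>s idp_law Q_ne"
  proof (rule char_fun_unique[OF law[OF Q] conv3(1,2)])
    fix a :: "int \<Rightarrow> real" assume a: "finite {i. a i \<noteq> 0}"
    have int: "integrable Q (lk_integrand a)"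
      by (rule integrable_lk[OF Q_sets stationary_levy_measure_coord[OF Q] a])
    note int_ind = integrable_mult_indicator[OF _ int]
    \<comment> \<open>Modulo null sets \<open>D\<close> lies in \<open>N0\<close> and
      \<open>P\<close> lies in \<open>Np\<close>. Hence \<open>N0\<close> splits into
      \<open>D\<close> and \<open>N0 - D\<close>, and \<open>Np\<close> into \<open>P\<close> and
      its intersection with \<open>N\<close>, so exactly one of the four indicators is
      \<open>1\<close> almost everywhere.\<close>
    have part: "AE x in Q. lk_integrand a x = indicator D x *\<^sub>R lk_integrand a x + indicator (N0 \<inter> C) x *\<^sub>R lk_integrand a x
        + indicator (Np \<inter> N) x *\<^sub>R lk_integrand a x + indicator P x *\<^sub>R lk_integrand a x"
      using AE_not_in[OF dissipative_part_zero_type[OF Q_sets D N0]]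
        AE_not_in[OF positive_part_zero_type[OF Q_sets Q_sf P N0]]
    proof eventually_elim
      case (elim x)
      then show ?case unfolding C by (auto simp: indicator_def compl)
    qed
    have "(CLINT x|Q. lk_integrand a x) = (CLINT x|Q. indicator D x *\<^sub>R lk_integrand a x + indicator (N0 \<inter> C) x *\<^sub>R lk_integrand a x
        + indicator (Np \<inter> N) x *\<^sub>R lk_integrand a x + indicator P x *\<^sub>R lk_integrand a x)"
      by (intro integral_cong_AE part borel_measurable_add borel_measurable_integrable int_ind int
          meas(1,2) sets_parts)
    also have "\<dots> = (CLINT x|Q_B. lk_integrand a x) + (CLINT x|Q_m. lk_integrand a x) + (CLINT x|Q_wm. lk_integrand a x) + (CLINT x|Q_ne. lk_integrand a x)"
      unfolding assms(9-12)
      by (simp only: integral_restr[OF _ borel_measurable_integrable[OF int]] int_ind meas(1,2) sets_parts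
          Bochner_Integration.integral_add Bochner_Integration.integrable_add)
    finally show "char_fun (idp_law Q) a =
        char_fun (idp_law Q_B \<star>\<^sub>s idp_law Q_m \<star>\<^sub>s idp_law Q_wm \<star>\<^sub>s idp_law Q_ne) a"
      by (simp add: conv1(3) conv2(3) conv3(3) law_cf[OF Q a] law_cf[OF B(1) a] law_cf[OF m(1) a]
          law_cf[OF wm(1) a] law_cf[OF ne(1) a] exp_add)
  qed
  moreover have "stable_law \<alpha> Q (idp_law Q)"
    using is_idp_law_of_idp_law[OF Q] scaling by (simp add: stable_law_def semi_stable_law_def)
  ultimately show ?thesis using B(2) m(2) wm(2) ne(2) by blast
qed

end
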